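(* Let $K$ be a compact Hausdorff space and let $X$ be a nontrivial complex Banach space endowed with a locally convex Hausdorff topology $\tau$ compatible to a dual pair. Let $A(K,(X,\tau))$ be an $(X,\tau)$-valued function space over a uniform algebra, with base algebra $A$. If $A$ is infinite dimensional, then $A(K,(X,\tau))$ has the diameter two property, i.e. every nonempty relatively weakly open subset of the closed unit ball of $A(K,(X,\tau))$ has diameter two.
   Context: A uniform algebra on a compact Hausdorff space $K$ is a (supremum-norm) closed subalgebra of the algebra $C(K)$ of complex-valued continuous functions on $K$ that separates the points of $K$ and contains the constant functions. A locally convex Hausdorff topology $\tau$ on a Banach space $X$ is compatible to a dual pair if either $(X,\tau)^*=X^*$ (the $\tau$-continuous linear functionals are exactly the norm-continuous ones), or $X$ is the dual of a Banach space $X_*$ and $(X,\tau)^*=X_*$ (the $\tau$-continuous linear functionals are exactly those given by evaluation at elements of $X_*$). $C(K,(X,\tau))$ is the Banach space of all continuous functions $f:K\to(X,\tau)$ with the norm $\|f\|=\sup_{t\in K}\|f(t)\|_X$. A closed subspace $A(K,(X,\tau))$ of $C(K,(X,\tau))$ is called an $(X,\tau)$-valued function space over a uniform algebra if (i) the base algebra $A:=\{y^*\circ f: f\in A(K,(X,\tau)),\ y^*\in (X,\tau)^*\}$ is a uniform algebra on $K$; and (ii) $\phi f\in A(K,(X,\tau))$ for every $\phi\in A$ and $f\in A(K,(X,\tau))$, where $(\phi f)(t)=\phi(t)f(t)$. *)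

theory Defs
  imports "HOL-Analysis.Analysis" "HOL-Library.Function_Algebras"
begin

section \<open>Complex vector spaces and complex Banach spaces\<close>

class scaleC =
  fixes scaleC :: "complex \<Rightarrow> 'a \<Rightarrow> 'a"  (infixr \<open>*\<^sub>C\<close> 75)

class complex_vector = ab_group_add + scaleC +
  assumes scaleC_add_right: "a *\<^sub>C (x + y) = a *\<^sub>C x + a *\<^sub>C y"
    and scaleC_add_left: "(a + b) *\<^sub>C x = a *\<^sub>C x + b *\<^sub>C x"
    and scaleC_scaleC: "a *\<^sub>C b *\<^sub>C x = (a * b) *\<^sub>C x"
    and scaleC_one: "1 *\<^sub>C x = x"

class complex_normed_vector = complex_vector + real_normed_vector +
  assumes scaleR_scaleC: "r *\<^sub>R x = complex_of_real r *\<^sub>C x"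
    and norm_scaleC: "norm (a *\<^sub>C x) = cmod a * norm x"

class cbanach = complex_normed_vector + complete_space

global_interpretation complex_vector: vector_space "scaleC :: complex \<Rightarrow> 'a \<Rightarrow> 'a::complex_vector"
  defines csubspace = complex_vector.subspace
    and cspan = complex_vector.span
  by unfold_locales (simp_all add: scaleC_add_right scaleC_add_left scaleC_scaleC scaleC_one)

instantiation complex :: cbanach
begin
definition scaleC_complex :: "complex \<Rightarrow> complex \<Rightarrow> complex" where
  "scaleC_complex a x = a * x"
instance
  by standard (simp_all add: scaleC_complex_def algebra_simps norm_mult scaleR_conv_of_real)
end

instantiation "fun" :: (type, complex_vector) complex_vector
begin
definition scaleC_fun :: "complex \<Rightarrow> ('a \<Rightarrow> 'b) \<Rightarrow> 'a \<Rightarrow> 'b" where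
  "scaleC_fun a f = (\<lambda>t. a *\<^sub>C f t)"
instance
  by standard
    (simp_all add: scaleC_fun_def fun_eq_iff scaleC_add_right scaleC_add_left scaleC_scaleC scaleC_one)
end


section \<open>Duals, weak topologies and the diameter two property\<close>

text \<open>A normed space is given here by a complex subspace \<open>V\<close> of an ambient complex vector space and
  a norm \<open>N\<close> on \<open>V\<close>. Functionals on \<open>V\<close> are represented by functions on the ambient type of which
  only the restriction to \<open>V\<close> matters; for \<open>V = UNIV\<close> the representation is unique.\<close>

definition normed_dual :: "'v::complex_vector set \<Rightarrow> ('v \<Rightarrow> real) \<Rightarrow> ('v \<Rightarrow> complex) set" where
  "normed_dual V N = {\<phi>. (\<forall>u\<in>V. \<forall>v\<in>V. \<phi> (u + v) = \<phi> u + \<phi> v) \<and>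
                         (\<forall>c. \<forall>u\<in>V. \<phi> (c *\<^sub>C u) = c * \<phi> u) \<and>
                         (\<exists>C. \<forall>u\<in>V. cmod (\<phi> u) \<le> C * N u)}"

definition weak_topology :: "'v::complex_vector set \<Rightarrow> ('v \<Rightarrow> real) \<Rightarrow> 'v topology" where
  "weak_topology V N = topology_generated_by {{v\<in>V. \<phi> v \<in> U} | \<phi> U. \<phi> \<in> normed_dual V N \<and> open U}"

definition norm_diameter :: "('v::complex_vector \<Rightarrow> real) \<Rightarrow> 'v set \<Rightarrow> real" where
  "norm_diameter N S = (if S = {} then 0 else SUP (u, v)\<in>S \<times> S. N (u - v))"

definition diameter_two_property :: "'v::complex_vector set \<Rightarrow> ('v \<Rightarrow> real) \<Rightarrow> bool" where
  "diameter_two_property V N \<longleftrightarrow>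
     (\<forall>W. openin (subtopology (weak_topology V N) {v\<in>V. N v \<le> 1}) W \<and> W \<noteq> {} \<longrightarrow>
          norm_diameter N W = 2)"


section \<open>Locally convex topologies compatible to a dual pair\<close>

definition locally_convex_Hausdorff :: "'x::complex_normed_vector topology \<Rightarrow> bool" where
  "locally_convex_Hausdorff \<tau> \<longleftrightarrow>
     topspace \<tau> = UNIV \<and> Hausdorff_space \<tau> \<and>
     continuous_map (prod_topology \<tau> \<tau>) \<tau> (\<lambda>(x, y). x + y) \<and>
     continuous_map (prod_topology euclidean \<tau>) \<tau> (\<lambda>(c, x). c *\<^sub>C x) \<and>
     neighbourhood_base_at 0 convex \<tau>"

definition topological_dual :: "'x::complex_vector topology \<Rightarrow> ('x \<Rightarrow> complex) set" where
  "topological_dual \<tau> = {\<phi>. (\<forall>x y. \<phi> (x + y) = \<phi> x + \<phi> y) \<and> (\<forall>c x. \<phi> (c *\<^sub>C x) = c * \<phi> x) \<and>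
                             continuous_map \<tau> euclidean \<phi>}"

text \<open>\<open>J\<close> exhibits \<open>'x\<close> as the dual of the Banach space \<open>'y\<close>: it is an isometric linear isomorphism
  of \<open>'x\<close> onto the dual of \<open>'y\<close> with the operator norm.\<close>

definition is_predual :: "('x::cbanach \<Rightarrow> 'y::cbanach \<Rightarrow> complex) \<Rightarrow> bool" where
  "is_predual J \<longleftrightarrow>
     (\<forall>x x'. J (x + x') = J x + J x') \<and> (\<forall>c x. J (c *\<^sub>C x) = c *\<^sub>C J x) \<and>
     (\<forall>x. onorm (J x) = norm x) \<and> range J = normed_dual UNIV norm"

text \<open>HOL has no quantification over types, so the predual \<open>'y\<close> and the identification \<open>J\<close> of \<open>'x\<close>
  with its dual are parameters. They are irrelevant for the first alternative.\<close>

definition compatible_to_dual_pair ::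
    "'x::cbanach topology \<Rightarrow> ('x \<Rightarrow> 'y::cbanach \<Rightarrow> complex) \<Rightarrow> bool" where
  "compatible_to_dual_pair \<tau> J \<longleftrightarrow>
     locally_convex_Hausdorff \<tau> \<and>
     (topological_dual \<tau> = normed_dual UNIV norm \<or>
      is_predual J \<and> topological_dual \<tau> = {(\<lambda>x. J x y) | y. True})"


section \<open>Function spaces over uniform algebras\<close>

text \<open>The compact Hausdorff space \<open>K\<close> is the type \<open>'k::t2_space\<close>; its compactness is an explicit
  hypothesis where it is used.\<close>

definition Cont :: "'x topology \<Rightarrow> ('k::topological_space \<Rightarrow> 'x) set" where
  "Cont \<tau> = {f. continuous_map euclidean \<tau> f}"

text \<open>If the domain is compact and \<open>\<tau>\<close> is compatible to a dual pair, then functions in \<open>Cont \<tau>\<close> are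
  norm bounded (uniform boundedness principle), so the supremum is a genuine one.\<close>

definition sup_norm :: "('k \<Rightarrow> 'x::real_normed_vector) \<Rightarrow> real" where
  "sup_norm f = (SUP t. norm (f t))"

definition sup_closed :: "'x::real_normed_vector topology \<Rightarrow> ('k::topological_space \<Rightarrow> 'x) set \<Rightarrow> bool" where
  "sup_closed \<tau> F \<longleftrightarrow>
     F \<subseteq> Cont \<tau> \<and> (\<forall>f\<in>Cont \<tau>. (\<forall>e>0. \<exists>g\<in>F. sup_norm (f - g) < e) \<longrightarrow> f \<in> F)"

definition uniform_algebra :: "('k::topological_space \<Rightarrow> complex) set \<Rightarrow> bool" where
  "uniform_algebra A \<longleftrightarrow>
     csubspace A \<and> (\<forall>f\<in>A. \<forall>g\<in>A. f * g \<in> A) \<and> sup_closed euclidean A \<and>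
     (\<forall>c. (\<lambda>t. c) \<in> A) \<and> (\<forall>s t. s \<noteq> t \<longrightarrow> (\<exists>f\<in>A. f s \<noteq> f t))"

definition base_algebra :: "'x::complex_vector topology \<Rightarrow> ('k \<Rightarrow> 'x) set \<Rightarrow> ('k \<Rightarrow> complex) set" where
  "base_algebra \<tau> F = {\<phi> \<circ> f | \<phi> f. f \<in> F \<and> \<phi> \<in> topological_dual \<tau>}"

definition function_space_over_uniform_algebra ::
    "'x::complex_normed_vector topology \<Rightarrow> ('k::topological_space \<Rightarrow> 'x) set \<Rightarrow> bool" where
  "function_space_over_uniform_algebra \<tau> F \<longleftrightarrow>
     csubspace F \<and> sup_closed \<tau> F \<and> uniform_algebra (base_algebra \<tau> F) \<and>
     (\<forall>\<phi>\<in>base_algebra \<tau> F. \<forall>f\<in>F. (\<lambda>t. \<phi> t *\<^sub>C f t) \<in> F)"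

definition infinite_dimensional :: "'v::complex_vector set \<Rightarrow> bool" where
  "infinite_dimensional V \<longleftrightarrow> \<not> (\<exists>B. finite B \<and> cspan B = V)"

end

theory Submission
  imports Defs
begin

text \<open>The strong boundary points \<open>\<Gamma>\<close> of the base algebra \<open>A\<close> are norming for \<open>A\<close>, hence also for the function
  space \<open>F\<close>, because \<open>(X, \<tau>)\<^sup>*\<close> is norming for \<open>X\<close>. As \<open>A\<close> is infinite dimensional, \<open>\<Gamma>\<close> is infinite, and there are
  arbitrarily many disjoint open sets \<open>U\<^sub>k\<close> that meet \<open>\<Gamma>\<close>. For each of them one finds \<open>b\<^sub>k \<in> A\<close>, peaking inside
  \<open>U\<^sub>k\<close> with values close to the interval \<open>[0, 1]\<close>, and \<open>y\<^sub>k \<in> F\<close> of norm almost one with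
  \<open>\<bar>1 - b\<^sub>k\<bar> + \<parallel>y\<^sub>k\<parallel> \<le> 1\<close> on \<open>\<Gamma>\<close> up to a small error. Then \<open>(1 - b\<^sub>k) f + y\<^sub>k\<close> and \<open>(1 - b\<^sub>k) f - y\<^sub>k\<close> almost belong to the unit ball
  whenever \<open>f\<close> does, and their distance is almost two. The supports being essentially disjoint, the sums of
  \<open>\<bar>\<phi> (b\<^sub>k f)\<bar>\<close> and of \<open>\<bar>\<phi> y\<^sub>k\<bar>\<close> over \<open>k\<close> are bounded independently of the number of sets, so for some \<open>k\<close> both
  functions lie in a prescribed weak neighbourhood of \<open>f\<close>.\<close>

section \<open>Hahn--Banach and uniform boundedness\<close>

definition sublinear :: "('a::real_vector \<Rightarrow> real) \<Rightarrow> bool" where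
  "sublinear p \<longleftrightarrow> (\<forall>x y. p (x + y) \<le> p x + p y) \<and> (\<forall>r\<ge>0. \<forall>x. p (r *\<^sub>R x) = r * p x)"

lemma sublinear_add: "sublinear p \<Longrightarrow> p (x + y) \<le> p x + p y"
  and sublinear_scale: "sublinear p \<Longrightarrow> r \<ge> 0 \<Longrightarrow> p (r *\<^sub>R x) = r * p x"
  by (auto simp: sublinear_def)

lemma sublinear_zero: "sublinear p \<Longrightarrow> p 0 = 0"
  using sublinear_scale [of p 0 0] by simp

lemma sublinear_minus: "sublinear p \<Longrightarrow> - p (- x) \<le> p x"
  using sublinear_add [of p x "- x"] sublinear_zero [of p] by simp

text \<open>Applying \<open>le\<close> to \<open>inverse r\<close> and \<open>r *\<^sub>R x\<close>
  reverses the inequality. For functionals defined as infima only this half of homogeneity is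
  immediate.\<close>

lemma sublinearI:
  assumes "\<And>x y. p (x + y) \<le> p x + p y" "p 0 = 0"
    and le: "\<And>r x. r > 0 \<Longrightarrow> p (r *\<^sub>R x) \<le> r * p x"
  shows "sublinear p"
proof -
  have "p (r *\<^sub>R x) = r * p x" if "r \<ge> 0" for r x
  proof (cases "r = 0")
    case False
    with that have r: "r > 0" by simp
    have "p x \<le> inverse r * p (r *\<^sub>R x)"
      using le [of "inverse r" "r *\<^sub>R x"] r by simp
    then have "r * p x \<le> p (r *\<^sub>R x)"
      using r by (simp add: field_simps)
    with le [OF r, of x] show ?thesis by simp
  qed (simp add: assms)
  with assms show ?thesis by (auto simp: sublinear_def)
qed

text \<open>Take the infimum of \<open>q (x + t *\<^sub>R y) - t * q y\<close> over
  \<open>t \<ge> 0\<close>: \<open>t = 0\<close> gives \<open>s \<le> q\<close> and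
  \<open>t = 1\<close> the last bound. At \<open>x = - y\<close> that bound reads
  \<open>s (- y) \<le> - q y\<close>, so \<open>q\<close> is pushed down along \<open>- y\<close> as
  far as \<open>q y\<close> permits.\<close>

lemma sublinear_lower:
  assumes q: "sublinear q"
  obtains s where "sublinear s" "s \<le> q" "\<And>x. s x \<le> q (x + y) - q y"
proof -
  define g where "g x t = q (x + t *\<^sub>R y) - t * q y" for x t
  define s where "s x = (INF t\<in>{0..}. g x t)" for x
  have lower: "- q (- x) \<le> g x t" if "t \<ge> 0" for x t
  proof -
    have "q (t *\<^sub>R y) \<le> q (x + t *\<^sub>R y) + q (- x)"
      using sublinear_add [OF q, of "x + t *\<^sub>R y" "- x"] by simp
    then show ?thesis using sublinear_scale [OF q that, of y] by (simp add: g_def)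
  qed
  have bdd: "bdd_below (g x ` {0..})" for x
    using lower by (auto intro!: bdd_belowI2)
  have s_le: "s x \<le> g x t" if "t \<ge> 0" for x t
    unfolding s_def using bdd that by (intro cINF_lower) auto
  have s_ge: "c \<le> s x" if "\<And>t. t \<ge> 0 \<Longrightarrow> c \<le> g x t" for c x
    unfolding s_def using that by (intro cINF_greatest) auto
  have "sublinear s"
  proof (rule sublinearI)
    show "s (x + x') \<le> s x + s x'" for x x'
    proof -
      have *: "s (x + x') \<le> g x t + g x' t'" if "t \<ge> 0" "t' \<ge> 0" for t t'
      proof -
        have "s (x + x') \<le> g (x + x') (t + t')" using that by (intro s_le) simp
        also have "\<dots> \<le> g x t + g x' t'"
          using sublinear_add [OF q, of "x + t *\<^sub>R y" "x' + t' *\<^sub>R y"]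
          by (simp add: g_def algebra_simps)
        finally show ?thesis .
      qed
      have "s (x + x') - g x' t' \<le> s x" if "t' \<ge> 0" for t'
        using * [OF _ that] by (intro s_ge) (simp add: algebra_simps)
      then have "s (x + x') - s x \<le> s x'"
        by (intro s_ge) (simp add: algebra_simps)
      then show ?thesis by simp
    qed
    have "g 0 t = 0" if "t \<ge> 0" for t
      using that sublinear_scale [OF q, of t y] by (simp add: g_def)
    then show "s 0 = 0" using s_le [of 0 0] s_ge [of 0 0] by force
    show "s (r *\<^sub>R x) \<le> r * s x" if "r > 0" for r x
    proof -
      have "s (r *\<^sub>R x) / r \<le> s x"
      proof (rule s_ge)
        fix t :: real assume "t \<ge> 0"
        then have "s (r *\<^sub>R x) \<le> g (r *\<^sub>R x) (r * t)" using that by (intro s_le) simp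
        also have "\<dots> = r * g x t"
          using sublinear_scale [OF q, of r "x + t *\<^sub>R y"] that by (simp add: g_def algebra_simps)
        finally show "s (r *\<^sub>R x) / r \<le> g x t" using that by (simp add: field_simps)
      qed
      then show ?thesis using that by (simp add: field_simps)
    qed
  qed
  moreover have "s \<le> q"
    using s_le [of 0] by (auto simp: le_fun_def g_def)
  moreover have "s x \<le> q (x + y) - q y" for x
    using s_le [of 1 x] by (simp add: g_def)
  ultimately show thesis using that by blast
qed

text \<open>The pointwise infimum of the chain is finite since \<open>- p (- x)\<close> bounds every
  member from below, and subadditive since any two members dominate a common one.\<close>

lemma sublinear_Inf_chain:
  assumes C: "\<And>q. q \<in> C \<Longrightarrow> sublinear q \<and> q \<le> p" and "C \<noteq> {}"
    and chain: "\<And>q r. q \<in> C \<Longrightarrow> r \<in> C \<Longrightarrow> q \<le> r \<or> r \<le> q"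
  obtains u where "sublinear u" "\<And>q. q \<in> C \<Longrightarrow> u \<le> q"
proof -
  define u where "u x = (INF q\<in>C. q x)" for x
  have "- p (- x) \<le> q x" if "q \<in> C" for q x
    using C [OF that] sublinear_minus [of q x] le_funD [of q p "- x"] by linarith
  then have bdd: "bdd_below ((\<lambda>q. q x) ` C)" for x
    by (auto intro!: bdd_belowI2)
  have u_le: "u x \<le> q x" if "q \<in> C" for q x
    unfolding u_def using bdd that by (intro cINF_lower) auto
  have u_ge: "c \<le> u x" if "\<And>q. q \<in> C \<Longrightarrow> c \<le> q x" for c x
    unfolding u_def using that \<open>C \<noteq> {}\<close> by (intro cINF_greatest) auto
  have "sublinear u"
  proof (rule sublinearI)
    show "u (x + y) \<le> u x + u y" for x y
    proof -
      have *: "u (x + y) \<le> q x + r y" if "q \<in> C" "r \<in> C" for q r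
      proof -
        obtain m where m: "m \<in> C" "m \<le> q" "m \<le> r"
          using chain [of q r] \<open>q \<in> C\<close> \<open>r \<in> C\<close> by blast
        have "u (x + y) \<le> m (x + y)" using m by (intro u_le)
        also have "\<dots> \<le> m x + m y" using C m by (intro sublinear_add) auto
        also have "\<dots> \<le> q x + r y" using m by (intro add_mono) (auto simp: le_fun_def)
        finally show ?thesis .
      qed
      have "u (x + y) - r y \<le> u x" if "r \<in> C" for r
        using * [OF _ that] by (intro u_ge) (simp add: algebra_simps)
      then have "u (x + y) - u x \<le> u y"
        by (intro u_ge) (simp add: algebra_simps)
      then show ?thesis by simp
    qed
    have "q 0 = 0" if "q \<in> C" for q
      using C that sublinear_zero by blast
    then have "(\<lambda>q. q 0) ` C = {0}" using \<open>C \<noteq> {}\<close> by force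
    then show "u 0 = 0" by (simp add: u_def)
    show "u (r *\<^sub>R x) \<le> r * u x" if "r > 0" for r x
    proof -
      have "u (r *\<^sub>R x) / r \<le> u x"
      proof (rule u_ge)
        fix q assume "q \<in> C"
        then show "u (r *\<^sub>R x) / r \<le> q x"
          using u_le [of q "r *\<^sub>R x"] C [of q] that by (simp add: field_simps sublinear_scale)
      qed
      then show ?thesis using that by (simp add: field_simps)
    qed
  qed
  then show thesis using that u_le by (simp add: le_fun_def)
qed

text \<open>A minimal sublinear functional is linear; this replaces the usual one-dimensional extension step
  of the Hahn--Banach theorem.\<close>

lemma sublinear_dominates_linear:
  fixes p :: "'a::real_vector \<Rightarrow> real"
  assumes p: "sublinear p"
  obtains u where "linear u" "u \<le> p"
proof -
  let ?A = "{q. sublinear q \<and> q \<le> p}"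
  have "\<exists>m\<in>?A. \<forall>q\<in>?A. q \<le> m \<longrightarrow> q = m"
  \<comment> \<open>Zorn's lemma for the reversed order: lower bounds of chains yield a minimal
    sublinear functional.\<close>
  proof (rule predicate_Zorn [where P = "\<lambda>q r. r \<le> q"])
    show "partial_order_on ?A (relation_of (\<lambda>q r. r \<le> q) ?A)"
      by (intro partial_order_on_relation_ofI) auto
    show "\<exists>u\<in>?A. \<forall>q\<in>C. u \<le> q" if "C \<in> Chains (relation_of (\<lambda>q r. r \<le> q) ?A)" for C
    proof (cases "C = {}")
      case True
      then show ?thesis using p by auto
    next
      case False
      have C: "sublinear q \<and> q \<le> p" if "q \<in> C" for q
        using \<open>C \<in> Chains _\<close> that by (auto simp: Chains_def relation_of_def)
      moreover have "q \<le> r \<or> r \<le> q" if "q \<in> C" "r \<in> C" for q r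
        using \<open>C \<in> Chains _\<close> that by (auto simp: Chains_def relation_of_def)
      ultimately obtain u where "sublinear u" "\<And>q. q \<in> C \<Longrightarrow> u \<le> q"
        using sublinear_Inf_chain [of C p] False by metis
      moreover have "u \<le> p" using False C calculation(2) order_trans by blast
      ultimately show ?thesis by blast
    qed
  qed
  then obtain m where m: "sublinear m" "m \<le> p" and min: "\<And>q. sublinear q \<Longrightarrow> q \<le> m \<Longrightarrow> q = m"
    using order_trans by blast
  have add: "m (x + y) = m x + m y" for x y
  proof -
    \<comment> \<open>Minimality turns \<open>s\<close> into \<open>m\<close>, so the bound on
      \<open>s\<close> becomes superadditivity of \<open>m\<close>.\<close>
    obtain s where "sublinear s" "s \<le> m" "\<And>x. s x \<le> m (x + y) - m y"
      using sublinear_lower [OF m(1)] by metis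
    then have "m x \<le> m (x + y) - m y" using min by metis
    with sublinear_add [OF m(1), of x y] show ?thesis by simp
  qed
  have neg: "m (- x) = - m x" for x
    using add [of x "- x"] sublinear_zero [OF m(1)] by simp
  have "m (r *\<^sub>R x) = r *\<^sub>R m x" for r x
  proof (cases "r \<ge> 0")
    case False
    then show ?thesis using sublinear_scale [OF m(1), of "- r" x] neg [of "r *\<^sub>R x"] by simp
  qed (simp add: sublinear_scale [OF m(1)])
  with add have "linear m" by (intro linearI) auto
  with m show thesis using that by blast
qed

text \<open>A linear functional below the norm lowered along \<open>- x\<close> satisfies
  \<open>u (- x) \<le> - norm x\<close>, which forces equality at \<open>x\<close>.\<close>

lemma real_norming_functional:
  fixes x :: "'a::real_normed_vector"
  obtains u where "linear u" "\<And>z. \<bar>u z\<bar> \<le> norm z" "u x = norm x"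
proof -
  have "sublinear (norm :: 'a \<Rightarrow> real)"
    by (simp add: sublinear_def norm_triangle_ineq)
  then obtain s where s: "sublinear s" "s \<le> (norm :: 'a \<Rightarrow> real)"
      "\<And>z. s z \<le> norm (z + x) - norm x"
    using sublinear_lower [where y = x] by metis
  obtain u where u: "linear u" "u \<le> s" using sublinear_dominates_linear [OF s(1)] by blast
  have le: "u z \<le> norm z" for z using u(2) s(2) by (metis le_fun_def order_trans)
  have neg: "u (- z) = - u z" for z using u(1) by (rule linear_neg)
  have "u (- x) \<le> - norm x" using u(2) s(3) [of "- x"] by (force simp: le_fun_def intro: order_trans)
  then have "u x = norm x" using le [of x] neg [of x] by simp
  moreover have "\<bar>u z\<bar> \<le> norm z" for z using le [of z] le [of "- z"] neg [of z] by simp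
  ultimately show thesis using that u(1) by blast
qed

text \<open>The closed sets \<open>S n\<close> cover a complete space, so by Baire one of them
  contains a ball; differences of points of this ball control all \<open>T i\<close> near the
  origin.\<close>

lemma uniform_boundedness:
  fixes T :: "'i \<Rightarrow> 'a::{real_normed_vector,complete_space} \<Rightarrow> 'b::real_normed_vector"
  assumes lin: "\<And>i. i \<in> I \<Longrightarrow> bounded_linear (T i)"
    and bdd: "\<And>x. \<exists>C. \<forall>i\<in>I. norm (T i x) \<le> C"
  shows "\<exists>C. \<forall>i\<in>I. \<forall>x. norm (T i x) \<le> C * norm x"
proof -
  define S where "S n = (\<Inter>i\<in>I. {x. norm (T i x) \<le> real n})" for n
  have closed: "closed (S n)" for n
    unfolding S_def
    by (intro closed_INT ballI closed_Collect_le continuous_intros bounded_linear.continuous_on [OF lin]) auto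
  have "(\<Union>n. S n) = UNIV"
  proof -
    have "\<exists>n. x \<in> S n" for x
    proof -
      obtain C where C: "\<forall>i\<in>I. norm (T i x) \<le> C" using bdd by blast
      obtain n where "C \<le> real n" using real_arch_simple by blast
      with C show ?thesis by (intro exI [of _ n]) (force simp: S_def)
    qed
    then show ?thesis by blast
  qed
  moreover have "interior (\<Union>n. S n) = {}" if "\<And>n. interior (S n) = {}"
  proof -
    have "complete (UNIV :: 'a set)" by (simp add: complete_UNIV)
    then show ?thesis
      using Met_TC.metric_Baire_category_alt [of "range S"] that closed by auto
  qed
  ultimately obtain n where "interior (S n) \<noteq> {}" by auto
  then obtain a r where r: "r > 0" "cball a r \<subseteq> S n"
    by (meson ex_in_conv mem_interior_cball)
  have "norm (T i x) \<le> (2 * real n / r) * norm x" if "i \<in> I" for i x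
  proof (cases "x = 0")
    case True
    then show ?thesis using bounded_linear.linear [OF lin [OF that]] by (simp add: linear_0)
  next
    case False
    interpret bounded_linear "T i" using lin that .
    \<comment> \<open>Scaled to norm \<open>r\<close>, so that \<open>a + y\<close> stays in the
      ball around \<open>a\<close>.\<close>
    define y where "y = (r / norm x) *\<^sub>R x"
    have "a \<in> S n" "a + y \<in> S n"
      using r False by (auto simp: y_def dist_norm intro!: subsetD [OF r(2)])
    then have "norm (T i a) \<le> n" "norm (T i (a + y)) \<le> n" using that by (auto simp: S_def)
    moreover have "T i y = T i (a + y) - T i a" by (simp add: add)
    ultimately have "norm (T i y) \<le> 2 * n" using norm_triangle_ineq4 [of "T i (a + y)" "T i a"] by simp
    moreover have "norm (T i y) = r / norm x * norm (T i x)" using r by (simp add: y_def scaleR)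
    ultimately show ?thesis using r False by (simp add: field_simps)
  qed
  then show ?thesis by blast
qed

section \<open>Strong boundary points\<close>

text \<open>Averaging with 1 moves every point of the closed disc except 1 into the open disc; high
  powers of \<open>(1 + g) / 2\<close> are therefore small away from the set where
  \<open>g = 1\<close>.\<close>

lemma norm_half_one_plus_less:
  fixes z :: complex
  assumes "cmod z \<le> 1" "z \<noteq> 1"
  shows "cmod ((1 + z) / 2) < 1"
proof -
  have sq: "(cmod z)\<^sup>2 \<le> 1" using assms(1) by (simp add: power_le_one)
  have "Re z < 1"
  proof (rule ccontr)
    assume "\<not> Re z < 1"
    then have "Re z \<ge> 1" by simp
    then have "(Re z)\<^sup>2 \<ge> 1" by (simp add: one_le_power)
    then have "(Im z)\<^sup>2 = 0" using sq zero_le_power2 [of "Im z"] unfolding cmod_power2 by linarith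
    then have "Im z = 0" by simp
    moreover have "Re z = 1" using \<open>Re z \<ge> 1\<close> assms(1) complex_Re_le_cmod [of z] by simp
    ultimately show False using assms(2) by (simp add: complex_eq_iff)
  qed
  moreover have "(cmod (1 + z))\<^sup>2 = 1 + 2 * Re z + (cmod z)\<^sup>2"
    unfolding cmod_power2 by (simp add: power2_eq_square algebra_simps)
  ultimately have "(cmod (1 + z))\<^sup>2 < 2\<^sup>2" using sq by simp
  then have "cmod (1 + z) < 2" by (rule power2_less_imp_less) simp
  then show ?thesis by (simp add: norm_divide)
qed

lemma sum_fun_apply: "(\<Sum>i\<in>I. f i) x = (\<Sum>i\<in>I. f i x :: 'a::comm_monoid_add)"
  by (induction I rule: infinite_finite_induct) auto

section \<open>Approximate peak sets and the boundary \<open>\<Gamma>\<close> of a separating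
  algebra\<close>

locale separating_algebra =
  fixes A :: "('k::t2_space \<Rightarrow> complex) set"
  assumes compact_space: "compact (UNIV :: 'k set)"
    and cont: "f \<in> A \<Longrightarrow> continuous_on UNIV f"
    and const: "(\<lambda>t. c) \<in> A"
    and add: "f \<in> A \<Longrightarrow> g \<in> A \<Longrightarrow> (\<lambda>t. f t + g t) \<in> A"
    and mult: "f \<in> A \<Longrightarrow> g \<in> A \<Longrightarrow> (\<lambda>t. f t * g t) \<in> A"
    and separating: "s \<noteq> t \<Longrightarrow> \<exists>f\<in>A. f s \<noteq> f t"
begin

lemma diff: "f \<in> A \<Longrightarrow> g \<in> A \<Longrightarrow> (\<lambda>t. f t - g t) \<in> A"
  using add [of f, OF _ mult [OF const [of "-1"]]] by simp

lemma power: "f \<in> A \<Longrightarrow> (\<lambda>t. f t ^ n) \<in> A"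
  by (induction n) (auto intro: const mult)

lemma prod: "(\<And>i. i \<in> I \<Longrightarrow> f i \<in> A) \<Longrightarrow> (\<lambda>t. \<Prod>i\<in>I. f i t) \<in> A"
  by (induction I rule: infinite_finite_induct) (auto intro: const mult)

lemma sum: "(\<And>i. i \<in> I \<Longrightarrow> f i \<in> A) \<Longrightarrow> (\<lambda>t. \<Sum>i\<in>I. f i t) \<in> A"
  by (induction I rule: infinite_finite_induct) (auto intro: const add)

lemma attains_max:
  assumes "f \<in> A"
  obtains t where "\<And>s. cmod (f s) \<le> cmod (f t)"
proof -
  have "\<exists>t\<in>UNIV. \<forall>s\<in>UNIV. cmod (f s) \<le> cmod (f t)"
    using compact_space cont [OF assms]
    by (intro continuous_attains_sup continuous_intros) auto
  then show thesis using that by blast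
qed

text \<open>An approximate version of the \<open>p\<close>-sets (intersections of peak sets) of the algebra, which needs
  no limits in \<open>A\<close>.\<close>

definition approx_peak :: "'k set \<Rightarrow> bool" where
  "approx_peak E \<longleftrightarrow> (\<forall>U e. open U \<and> E \<subseteq> U \<and> e > 0 \<longrightarrow>
     (\<exists>a\<in>A. (\<forall>s. cmod (a s) \<le> 1 + e) \<and> (\<forall>s\<in>E. cmod (a s - 1) \<le> e) \<and> (\<forall>s. s \<notin> U \<longrightarrow> cmod (a s) \<le> e)))"

lemma approx_peakE:
  assumes "approx_peak E" "open U" "E \<subseteq> U" "e > 0"
  obtains a where "a \<in> A" "\<And>s. cmod (a s) \<le> 1 + e" "\<And>s. s \<in> E \<Longrightarrow> cmod (a s - 1) \<le> e"
    "\<And>s. s \<notin> U \<Longrightarrow> cmod (a s) \<le> e"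
  using assms unfolding approx_peak_def by metis

lemma approx_peak_UNIV: "approx_peak UNIV"
  unfolding approx_peak_def by (intro allI impI bexI [OF _ const [of 1]]) auto

text \<open>A high power of \<open>(1 + g) / 2\<close> is 1 where \<open>g = 1\<close> and uniformly
  small on the compact set \<open>E - U\<close>. Since it may be large off \<open>E\<close>, it is
  multiplied by a function of \<open>A\<close> that peaks on \<open>E\<close> and is tiny outside a
  neighbourhood \<open>V\<close> of \<open>E\<close>.\<close>

lemma approx_peak_refine:
  assumes E: "approx_peak E" "closed E" and g: "g \<in> A" and le: "\<And>s. s \<in> E \<Longrightarrow> cmod (g s) \<le> 1"
  shows "approx_peak {s\<in>E. g s = 1}"
  unfolding approx_peak_def
proof (intro allI impI, elim conjE)
  fix U and e :: real
  assume U: "open U" "{s\<in>E. g s = 1} \<subseteq> U" and "e > 0"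
  define d where "d = min 1 e / 3"
  have d: "d > 0" "(1 + d) * (1 + d) \<le> 1 + e" "(1 + d) * d \<le> e" "d \<le> e"
  proof -
    show "d > 0" using \<open>e > 0\<close> by (simp add: d_def)
    have *: "d \<le> 1" "3 * d \<le> e" by (auto simp: d_def)
    then have "d * d \<le> d" using \<open>d > 0\<close> by (simp add: mult_left_le)
    with * \<open>d > 0\<close> show "(1 + d) * (1 + d) \<le> 1 + e" "(1 + d) * d \<le> e" "d \<le> e"
      unfolding distrib_left distrib_right mult_1 mult_1_right by linarith+
  qed
  define h where "h s = (1 + g s) / 2" for s
  have hA: "h \<in> A"
    using mult [OF const [of "1/2"] add [OF const [of 1] g]] by (simp add: h_def [abs_def])
  have h_le: "cmod (h s) \<le> 1" if "s \<in> E" for s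
    using norm_triangle_ineq [of 1 "g s"] le [OF that] by (simp add: h_def norm_divide)
  obtain n where n: "cmod (h s) ^ n < d" if "s \<in> E - U" for s
  proof (cases "E - U = {}")
    case False
    have "compact (E - U)"
      using compact_Int_closed [OF compact_space, of "E - U"] E U by (simp add: closed_Diff)
    moreover have "continuous_on (E - U) (\<lambda>s. cmod (h s))"
      using cont [OF hA] by (intro continuous_intros) (auto intro: continuous_on_subset)
    ultimately obtain s0 where s0: "s0 \<in> E - U" "\<And>s. s \<in> E - U \<Longrightarrow> cmod (h s) \<le> cmod (h s0)"
      using continuous_attains_sup [of "E - U" "\<lambda>s. cmod (h s)"] False by blast
    have "cmod (h s0) < 1"
      unfolding h_def using s0 U by (intro norm_half_one_plus_less le) auto
    then obtain n where "cmod (h s0) ^ n < d"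
      using real_arch_pow_inv [OF d(1)] by blast
    then show thesis using s0 by (intro that [of n]) (meson le_less_trans norm_ge_zero power_mono)
  qed (use that in auto)
  \<comment> \<open>The open neighbourhood of \<open>E\<close> on which the power is under control:
    almost at most 1 everywhere, and below \<open>d\<close> outside \<open>U\<close>.\<close>
  define V where "V = {s. cmod (h s) ^ n < 1 + d} \<inter> (U \<union> {s. cmod (h s) ^ n < d})"
  have "open V"
    unfolding V_def using U cont [OF hA]
    by (intro open_Int open_Un open_Collect_less continuous_intros) auto
  moreover have "E \<subseteq> V"
  proof
    fix s assume "s \<in> E"
    then have "cmod (h s) ^ n \<le> 1" using h_le by (simp add: power_le_one)
    then show "s \<in> V" using n [of s] \<open>s \<in> E\<close> d(1) by (auto simp: V_def)
  qed
  moreover obtain t where t: "\<And>s. cmod (h s) \<le> cmod (h t)" using attains_max [OF hA] by blast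
  \<comment> \<open>A global bound for the power; with tolerance \<open>d / B\<close> for
    \<open>a\<close>, the product is at most \<open>d\<close> off \<open>V\<close>.\<close>
  define B where "B = max 1 (cmod (h t) ^ n)"
  have B: "cmod (h s) ^ n \<le> B" "B \<ge> 1" for s
    using power_mono [OF t, of s n] by (auto simp: B_def)
  have "d / B > 0" "d / B \<le> d" using d(1) B(2) by (auto simp: divide_le_eq mult_le_cancel_left1)
  ultimately obtain a where a: "a \<in> A" "\<And>s. cmod (a s) \<le> 1 + d / B"
      "\<And>s. s \<in> E \<Longrightarrow> cmod (a s - 1) \<le> d / B" "\<And>s. s \<notin> V \<Longrightarrow> cmod (a s) \<le> d / B"
    using approx_peakE [OF E(1)] by metis
  define b where "b s = a s * h s ^ n" for s
  have off_V: "cmod (b s) \<le> d" if "s \<notin> V" for s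
  proof -
    have "cmod (b s) \<le> d / B * B"
      unfolding b_def norm_mult norm_power using that a(4) B d(1) by (intro mult_mono) auto
    then show ?thesis using B(2) by simp
  qed
  have on_V: "cmod (b s) \<le> (1 + d) * c" if "cmod (h s) ^ n \<le> c" for s c
    unfolding b_def norm_mult norm_power using that a(2) [of s] \<open>d / B \<le> d\<close> d(1)
    by (intro mult_mono) auto
  show "\<exists>a\<in>A. (\<forall>s. cmod (a s) \<le> 1 + e) \<and> (\<forall>s\<in>{s \<in> E. g s = 1}. cmod (a s - 1) \<le> e) \<and>
           (\<forall>s. s \<notin> U \<longrightarrow> cmod (a s) \<le> e)"
  proof (intro bexI conjI allI ballI impI)
    show "b \<in> A" unfolding b_def using a hA by (intro mult power)
    show "cmod (b s) \<le> 1 + e" for s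
      using off_V [of s] on_V [of s "1 + d"] d by (cases "s \<in> V") (auto simp: V_def)
    show "cmod (b s - 1) \<le> e" if "s \<in> {s \<in> E. g s = 1}" for s
      using a(3) [of s] that \<open>d / B \<le> d\<close> d(4) by (simp add: b_def h_def)
    show "cmod (b s) \<le> e" if "s \<notin> U" for s
      using off_V [of s] on_V [of s d] d that by (cases "s \<in> V") (auto simp: V_def)
  qed
qed

text \<open>The strong boundary points, in the approximate sense of
  \<open>approx_peak\<close>.\<close>

definition \<Gamma> :: "'k set" where
  "\<Gamma> = {t. approx_peak {t}}"

text \<open>By compactness every open set around the intersection contains some member of the chain,
  and a function peaking on that member also serves for the intersection. The open set
  \<open>{}\<close> gives nonemptiness.\<close>

lemma approx_peak_Inter_chain:
  assumes C: "\<And>E. E \<in> C \<Longrightarrow> closed E \<and> E \<noteq> {} \<and> approx_peak E" and "C \<noteq> {}"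
    and chain: "\<And>E E'. E \<in> C \<Longrightarrow> E' \<in> C \<Longrightarrow> E \<subseteq> E' \<or> E' \<subseteq> E"
  shows "\<Inter>C \<noteq> {} \<and> approx_peak (\<Inter>C)"
proof -
  have fin: "\<Inter>C' \<in> C" if "finite C'" "C' \<subseteq> C" "C' \<noteq> {}" for C'
    using that(1,3,2)
  proof (induction rule: finite_ne_induct)
    case (insert E C')
    then show ?case using chain [of E "\<Inter>C'"] by (auto simp: inf_absorb1 inf_absorb2)
  qed simp
  have key: "\<exists>E\<in>C. E \<subseteq> U" if "open U" "\<Inter>C \<subseteq> U" for U
  proof (rule ccontr)
    assume contr: "\<not> (\<exists>E\<in>C. E \<subseteq> U)"
    have "(- U) \<inter> \<Inter>C \<noteq> {}"
    proof (rule compact_imp_fip)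
      show "compact (- U)"
        using compact_Int_closed [OF compact_space, of "- U"] that by (simp add: closed_def)
      show "- U \<inter> \<Inter>C' \<noteq> {}" if "finite C'" "C' \<subseteq> C" for C'
        using fin [OF that] contr \<open>C \<noteq> {}\<close> by (cases "C' = {}") auto
    qed (use C in auto)
    then show False using that by blast
  qed
  have "\<Inter>C \<noteq> {}" using key [of "{}"] C by auto
  moreover have "approx_peak (\<Inter>C)"
    unfolding approx_peak_def
  proof (intro allI impI, elim conjE)
    fix U and e :: real
    assume "open U" "\<Inter>C \<subseteq> U" "e > 0"
    moreover obtain E where E: "E \<in> C" "E \<subseteq> U" using key calculation by blast
    ultimately obtain a where "a \<in> A" "\<And>s. cmod (a s) \<le> 1 + e" "\<And>s. s \<in> E \<Longrightarrow> cmod (a s - 1) \<le> e"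
        "\<And>s. s \<notin> U \<Longrightarrow> cmod (a s) \<le> e"
      using approx_peakE C by metis
    then show "\<exists>a\<in>A. (\<forall>s. cmod (a s) \<le> 1 + e) \<and> (\<forall>s\<in>\<Inter>C. cmod (a s - 1) \<le> e) \<and>
           (\<forall>s. s \<notin> U \<longrightarrow> cmod (a s) \<le> e)"
      using E by blast
  qed
  ultimately show ?thesis by blast
qed

text \<open>A minimal closed nonempty approximate peak set is a singleton: if some \<open>f\<close>
  in \<open>A\<close> took two values on it, normalizing \<open>f\<close> at a point where its
  modulus is maximal on the set and refining would produce a smaller one.\<close>

lemma approx_peak_meets_\<Gamma>:
  assumes E0: "closed E0" "E0 \<noteq> {}" "approx_peak E0"
  shows "E0 \<inter> \<Gamma> \<noteq> {}"
proof -
  let ?P = "{E. closed E \<and> E \<noteq> {} \<and> approx_peak E \<and> E \<subseteq> E0}"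
  have "\<exists>M\<in>?P. \<forall>E\<in>?P. E \<subseteq> M \<longrightarrow> E = M"
  proof (rule predicate_Zorn [where P = "\<lambda>E E'. E' \<subseteq> E"])
    show "partial_order_on ?P (relation_of (\<lambda>E E'. E' \<subseteq> E) ?P)"
      by (intro partial_order_on_relation_ofI) auto
    show "\<exists>M\<in>?P. \<forall>E\<in>C. M \<subseteq> E" if "C \<in> Chains (relation_of (\<lambda>E E'. E' \<subseteq> E) ?P)" for C
    proof (cases "C = {}")
      case True
      then show ?thesis using E0 by auto
    next
      case False
      have C: "closed E \<and> E \<noteq> {} \<and> approx_peak E \<and> E \<subseteq> E0" if "E \<in> C" for E
        using \<open>C \<in> Chains _\<close> that by (auto simp: Chains_def relation_of_def)
      moreover have "E \<subseteq> E' \<or> E' \<subseteq> E" if "E \<in> C" "E' \<in> C" for E E'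
        using \<open>C \<in> Chains _\<close> that by (auto simp: Chains_def relation_of_def)
      ultimately have "\<Inter>C \<noteq> {} \<and> approx_peak (\<Inter>C)"
        using False by (intro approx_peak_Inter_chain) auto
      moreover have "closed (\<Inter>C)" using C by (intro closed_Inter) auto
      moreover have "\<Inter>C \<subseteq> E0" using C False by blast
      ultimately show ?thesis by blast
    qed
  qed
  then obtain M where M: "closed M" "M \<noteq> {}" "approx_peak M" "M \<subseteq> E0"
    and min: "\<And>E. closed E \<Longrightarrow> E \<noteq> {} \<Longrightarrow> approx_peak E \<Longrightarrow> E \<subseteq> M \<Longrightarrow> E = M"
    by (smt (verit, best) mem_Collect_eq order_trans)
  obtain t where t: "t \<in> M" using M(2) by blast
  have "s = t" if "s \<in> M" for s
  proof (rule ccontr)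
    assume "s \<noteq> t"
    then obtain f where f: "f \<in> A" "f s \<noteq> f t" using separating by blast
    have "compact M" using compact_Int_closed [OF compact_space M(1)] by simp
    moreover have "continuous_on M (\<lambda>s. cmod (f s))"
      using cont [OF f(1)] by (intro continuous_intros) (auto intro: continuous_on_subset)
    ultimately obtain m where m: "m \<in> M" "\<And>s. s \<in> M \<Longrightarrow> cmod (f s) \<le> cmod (f m)"
      using continuous_attains_sup [of M "\<lambda>s. cmod (f s)"] M(2) by blast
    have nz: "f m \<noteq> 0" using m(2) [OF t] m(2) [OF that] f(2) by auto
    define g where "g u = inverse (f m) * f u" for u
    have gA: "g \<in> A" unfolding g_def using mult [OF const f(1)] .
    have "cmod (g u) \<le> 1" if "u \<in> M" for u
      using m(2) [OF that] nz by (simp add: g_def norm_mult norm_inverse norm_divide divide_simps)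
    then have "approx_peak {u\<in>M. g u = 1}" using gA M by (intro approx_peak_refine) auto
    moreover have "closed {u\<in>M. g u = 1}"
    proof -
      have "closed {u. g u = 1}" using cont [OF gA] by (intro closed_Collect_eq continuous_intros) auto
      then show ?thesis using closed_Int [OF M(1)] by (simp add: Collect_conj_eq)
    qed
    moreover have "m \<in> {u\<in>M. g u = 1}" using m nz by (simp add: g_def)
    ultimately have "{u\<in>M. g u = 1} = M" by (intro min) auto
    then have "g s = 1" "g t = 1" using that t by auto
    then show False using f(2) nz by (simp add: g_def field_simps)
  qed
  then have "M = {t}" using t by blast
  then have "t \<in> \<Gamma>" using M(3) by (simp add: \<Gamma>_def)
  then show ?thesis using t M(4) by blast
qed

text \<open>The points where \<open>f\<close> takes a fixed value of maximal modulus form a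
  refinement of the whole space, hence meet \<open>\<Gamma>\<close>.\<close>

lemma norming_on_\<Gamma>:
  assumes f: "f \<in> A"
  obtains t where "t \<in> \<Gamma>" "\<And>s. cmod (f s) \<le> cmod (f t)"
proof -
  obtain m where m: "\<And>s. cmod (f s) \<le> cmod (f m)" using attains_max [OF f] by blast
  \<comment> \<open>If the maximum is 0, then \<open>f\<close> vanishes identically and the constant
    1 makes the refined set the whole space.\<close>
  define g where "g u = (if f m = 0 then 1 else inverse (f m) * f u)" for u
  have gA: "g \<in> A"
    unfolding g_def using mult [OF const f, of "inverse (f m)"] const [of 1] by (cases "f m = 0") simp_all
  have "cmod (g u) \<le> 1" for u
    using m [of u] by (simp add: g_def norm_mult norm_inverse norm_divide divide_simps)
  then have "approx_peak {u\<in>UNIV. g u = 1}"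
    using gA approx_peak_UNIV by (intro approx_peak_refine) auto
  moreover have "closed {u. g u = 1}" using cont [OF gA] by (intro closed_Collect_eq continuous_intros) auto
  moreover have "g m = 1" by (simp add: g_def)
  ultimately have "{u. g u = 1} \<inter> \<Gamma> \<noteq> {}" by (intro approx_peak_meets_\<Gamma>) auto
  then obtain t where t: "g t = 1" "t \<in> \<Gamma>" by blast
  then have "f t = f m" using m [of t] by (auto simp: g_def field_simps split: if_splits)
  then show thesis using that t m by simp
qed

text \<open>Adding a function that peaks at \<open>t\<close> where the sum of the previous ones is almost \<open>n\<close> keeps the
  sum near the real interval \<open>[0, n + 1]\<close>.\<close>

lemma staircase:
  fixes d :: real
  assumes t: "t \<in> \<Gamma>" and U: "open U" "t \<in> U" and "d > 0"
  shows "\<exists>b\<in>A. cmod (b t - of_nat n) \<le> n * d \<and> (\<forall>s. s \<notin> U \<longrightarrow> cmod (b s) \<le> n * d) \<and>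
    (\<forall>s. \<exists>r\<in>{0..real n}. cmod (b s - of_real r) \<le> 1 + (2 * real n + 2) * d)"
proof (induction n)
  case 0
  show ?case using const [of 0] \<open>d > 0\<close> by (intro bexI [of _ "\<lambda>_. 0"]) auto
next
  case (Suc n)
  then obtain b where b: "b \<in> A" "cmod (b t - of_nat n) \<le> n * d" "\<And>s. s \<notin> U \<Longrightarrow> cmod (b s) \<le> n * d"
    and r: "\<And>s. \<exists>r\<in>{0..real n}. cmod (b s - of_real r) \<le> 1 + (2 * real n + 2) * d" by blast
  \<comment> \<open>The next summand may be large only where the sum is already close to
    \<open>n\<close>. The radius has \<open>n + 1\<close> instead of \<open>n\<close> so that the
    strict inequality holds at \<open>t\<close>.\<close>
  define V where "V = U \<inter> {s. cmod (b s - of_nat n) < (real n + 1) * d}"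
  have "open V" unfolding V_def using U cont [OF b(1)]
    by (intro open_Int open_Collect_less continuous_intros) auto
  moreover have "t \<in> V" using U b(2) \<open>d > 0\<close> by (auto simp: V_def algebra_simps)
  ultimately obtain a where a: "a \<in> A" "\<And>s. cmod (a s) \<le> 1 + d" "cmod (a t - 1) \<le> d"
      "\<And>s. s \<notin> V \<Longrightarrow> cmod (a s) \<le> d"
    using t \<open>d > 0\<close> approx_peakE [of "{t}" V d] unfolding \<Gamma>_def by auto
  show ?case
  proof (intro bexI [of _ "\<lambda>s. b s + a s"] conjI allI impI)
    show "(\<lambda>s. b s + a s) \<in> A" using a b by (intro add)
    have "cmod (b t + a t - of_nat (Suc n)) \<le> cmod (b t - of_nat n) + cmod (a t - 1)"
      using norm_triangle_ineq [of "b t - of_nat n" "a t - 1"] by (simp add: algebra_simps)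
    then show "cmod (b t + a t - of_nat (Suc n)) \<le> Suc n * d"
      using b(2) a(3) by (simp add: algebra_simps)
    show "cmod (b s + a s) \<le> Suc n * d" if "s \<notin> U" for s
      using norm_triangle_ineq [of "b s" "a s"] b(3) [OF that] a(4) [of s] that
      by (simp add: V_def algebra_simps)
    show "\<exists>r\<in>{0..real (Suc n)}. cmod (b s + a s - of_real r) \<le> 1 + (2 * real (Suc n) + 2) * d" for s
    proof (cases "s \<in> V")
      case True
      then have "cmod (b s - of_nat n) < (real n + 1) * d" by (simp add: V_def)
      moreover have "(real n + 1) * d \<le> (2 * real n + 2) * d" using \<open>d > 0\<close> by (intro mult_right_mono) auto
      moreover have "cmod (b s + a s - of_nat n) \<le> cmod (b s - of_nat n) + cmod (a s)"
        using norm_triangle_ineq [of "b s - of_nat n" "a s"] by (simp add: algebra_simps)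
      moreover have "(2 * real (Suc n) + 2) * d = (2 * real n + 2) * d + 2 * d"
        by (simp add: algebra_simps)
      ultimately have "cmod (b s + a s - of_nat n) \<le> 1 + (2 * real (Suc n) + 2) * d"
        using a(2) [of s] \<open>d > 0\<close> by linarith
      \<comment> \<open>On \<open>V\<close> the sum before this step is near \<open>n\<close> and
        the new summand has modulus at most \<open>1 + d\<close>; this is the source of the constant
        1 in the distance to the interval.\<close>
      then show ?thesis by (intro bexI [of _ "real n"]) auto
    next
      case False
      obtain q where q: "q \<in> {0..real n}" "cmod (b s - of_real q) \<le> 1 + (2 * real n + 2) * d" using r by blast
      have "cmod (b s + a s - of_real q) \<le> cmod (b s - of_real q) + cmod (a s)"
        using norm_triangle_ineq [of "b s - of_real q" "a s"] by (simp add: algebra_simps)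
      then show ?thesis using q a(4) [OF False] \<open>d > 0\<close>
        by (intro bexI [of _ q]) (auto simp: algebra_simps)
    qed
  qed
qed

text \<open>Dividing the staircase by its height \<open>n\<close> makes the bounded distance to
  \<open>[0, n]\<close> a distance of order \<open>1 / n\<close> to \<open>[0, 1]\<close>, and
  \<open>p + (1 - p) = 1\<close> for points \<open>p\<close> of that interval.\<close>

lemma stolz_peak:
  assumes t: "t \<in> \<Gamma>" and U: "open U" "t \<in> U" and "e > 0"
  obtains b where "b \<in> A" "cmod (b t - 1) \<le> e" "\<And>s. cmod (b s) + cmod (1 - b s) \<le> 1 + e"
    "\<And>s. s \<notin> U \<Longrightarrow> cmod (b s) \<le> e"
proof -
  obtain n :: nat where n: "10 / e < real n" using reals_Archimedean2 by blast
  have "n > 0" using n \<open>e > 0\<close> by (auto intro!: Nat.gr0I simp: field_simps)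
  \<comment> \<open>The bound \<open>n * d \<le> n * e\<close> serves at \<open>t\<close> and off
    \<open>U\<close>. The bound \<open>n * d \<le> 1\<close> keeps the staircase error below 5, so
    after division it is below \<open>e / 2\<close>, which enters twice.\<close>
  define d where "d = min e (1 / n)"
  have "d > 0" using \<open>e > 0\<close> \<open>n > 0\<close> by (simp add: d_def)
  obtain b where b: "b \<in> A" "cmod (b t - of_nat n) \<le> n * d" "\<And>s. s \<notin> U \<Longrightarrow> cmod (b s) \<le> n * d"
    and r: "\<And>s. \<exists>r\<in>{0..real n}. cmod (b s - of_real r) \<le> 1 + (2 * real n + 2) * d"
    using staircase [OF t U \<open>d > 0\<close>, of n] by blast
  have nd: "n * d \<le> n * e" "n * d \<le> 1"
    using \<open>n > 0\<close> by (auto simp: d_def min_def field_simps)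
  define c where "c s = inverse (of_nat n) * b s" for s
  show thesis
  proof (rule that)
    show "c \<in> A" unfolding c_def using b(1) by (intro mult const)
    have c_minus: "cmod (c s - z) = cmod (b s - of_nat n * z) / n" for s z
    proof -
      have "c s - z = (b s - of_nat n * z) / of_nat n"
        using \<open>n > 0\<close> by (simp add: c_def field_simps)
      then show ?thesis by (simp add: norm_divide)
    qed
    show "cmod (c t - 1) \<le> e"
      using c_minus [of t 1] order_trans [OF b(2) nd(1)] \<open>n > 0\<close> by (simp add: pos_divide_le_eq mult.commute)
    show "cmod (c s) \<le> e" if "s \<notin> U" for s
      using c_minus [of s 0] order_trans [OF b(3) [OF that] nd(1)] \<open>n > 0\<close>
      by (simp add: pos_divide_le_eq mult.commute)
    show "cmod (c s) + cmod (1 - c s) \<le> 1 + e" for s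
    proof -
      obtain q where q: "0 \<le> q" "q \<le> real n" "cmod (b s - of_real q) \<le> 1 + (2 * real n + 2) * d"
        using r [of s] by auto
      have "1 * d \<le> real n * d" using \<open>n > 0\<close> \<open>d > 0\<close> by (intro mult_right_mono) auto
      then have "d \<le> 1" using nd(2) by linarith
      then have "1 + (2 * real n + 2) * d \<le> 5" using nd(2) by (simp add: algebra_simps)
      define p where "p = q / n"
      have p: "0 \<le> p" "p \<le> 1" using q \<open>n > 0\<close> by (auto simp: p_def)
      have "cmod (c s - of_real p) \<le> 5 / n"
        using c_minus [of s "of_real p"] q(3) \<open>1 + _ \<le> 5\<close> \<open>n > 0\<close>
        by (simp add: p_def divide_right_mono)
      moreover have "5 / n \<le> e / 2" using n \<open>n > 0\<close> \<open>e > 0\<close> by (simp add: field_simps)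
      ultimately have "cmod (c s - of_real p) \<le> e / 2" by simp
      moreover have "cmod (c s) \<le> p + cmod (c s - of_real p)"
        using norm_triangle_ineq [of "of_real p" "c s - of_real p"] p by simp
      moreover have "cmod (1 - c s) \<le> (1 - p) + cmod (c s - of_real p)"
        using norm_triangle_ineq4 [of "of_real (1 - p)" "c s - of_real p"] p
        by (simp del: of_real_diff) (simp add: algebra_simps)
      ultimately show ?thesis by simp
    qed
  qed
qed

text \<open>Lagrange interpolation: if \<open>\<Gamma>\<close> is finite, products of separating
  functions give \<open>e t\<close> in \<open>A\<close> that are 1 at \<open>t\<close> and 0 on the
  rest of \<open>\<Gamma>\<close>. An element of \<open>A\<close> minus its interpolant vanishes on
  \<open>\<Gamma>\<close>, hence everywhere, so the \<open>e t\<close> span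
  \<open>A\<close>.\<close>

lemma infinite_\<Gamma>:
  assumes "infinite_dimensional A"
  shows "infinite \<Gamma>"
proof
  assume fin: "finite \<Gamma>"
  have "\<exists>h\<in>A. h t = 1 \<and> h s = 0" if "s \<noteq> t" for s t
  proof -
    obtain f where f: "f \<in> A" "f s \<noteq> f t" using separating [OF \<open>s \<noteq> t\<close>] by blast
    have "(\<lambda>u. inverse (f t - f s) * (f u - f s)) \<in> A"
      using f(1) by (intro mult diff const)
    then show ?thesis using f(2) by (intro bexI [of _ "\<lambda>u. inverse (f t - f s) * (f u - f s)"]) auto
  qed
  then have "\<forall>t s. \<exists>h. s \<noteq> t \<longrightarrow> h \<in> A \<and> h t = 1 \<and> h s = 0" by blast
  then have "\<exists>h. \<forall>t s. s \<noteq> t \<longrightarrow> h t s \<in> A \<and> h t s t = 1 \<and> h t s s = 0"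
    by (simp only: choice_iff)
  then obtain h where h: "\<And>s t. s \<noteq> t \<Longrightarrow> h t s \<in> A \<and> h t s t = 1 \<and> h t s s = 0" by blast
  define e where "e t = (\<lambda>u. \<Prod>s\<in>\<Gamma>-{t}. h t s u)" for t
  have eA: "e t \<in> A" for t unfolding e_def using h by (intro prod) auto
  have e1: "e t t = 1" for t unfolding e_def using h by (intro prod.neutral) auto
  have e0: "e t s = 0" if "s \<in> \<Gamma>" "s \<noteq> t" for s t
    unfolding e_def using that fin h by (intro prod_zero) auto
  have "f \<in> cspan (e ` \<Gamma>)" if "f \<in> A" for f
  proof -
    define g where "g u = f u - (\<Sum>t\<in>\<Gamma>. f t * e t u)" for u
    have "g \<in> A" unfolding g_def using that eA by (intro diff sum mult const)
    moreover have "g u = 0" if "u \<in> \<Gamma>" for u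
    proof -
      have "(\<Sum>t\<in>\<Gamma>. f t * e t u) = (\<Sum>t\<in>\<Gamma>. if t = u then f u else 0)"
        using e1 e0 that by (intro sum.cong) auto
      then show ?thesis using that fin by (simp add: g_def)
    qed
    ultimately have g0: "g u = 0" for u using norming_on_\<Gamma> [of g] by (metis norm_le_zero_iff norm_zero)
    have "f u = (\<Sum>t\<in>\<Gamma>. f t *\<^sub>C e t) u" for u
      using g0 [of u] by (simp add: g_def scaleC_fun_def scaleC_complex_def sum_fun_apply)
    then have "f = (\<Sum>t\<in>\<Gamma>. f t *\<^sub>C e t)" by (rule ext)
    also have "\<dots> \<in> cspan (e ` \<Gamma>)"
      by (intro complex_vector.span_sum complex_vector.span_scale complex_vector.span_base) auto
    finally show ?thesis .
  qed
  moreover have "cspan (e ` \<Gamma>) \<subseteq> A"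
  proof (rule complex_vector.span_minimal)
    show "e ` \<Gamma> \<subseteq> A" using eA by blast
    show "csubspace A"
      using const [of 0] add mult [OF const]
      by (auto simp: complex_vector.subspace_def plus_fun_def zero_fun_def scaleC_fun_def scaleC_complex_def)
  qed
  ultimately have "cspan (e ` \<Gamma>) = A" by blast
  then show False using assms fin unfolding infinite_dimensional_def by blast
qed

end

section \<open>Nearly antipodal points in weak neighbourhoods\<close>

lemma weak_topology_neighbourhood:
  assumes "openin (weak_topology V N) S" "v \<in> S"
  shows "\<exists>\<Phi> e. finite \<Phi> \<and> \<Phi> \<subseteq> normed_dual V N \<and> e > 0 \<and>
    {w\<in>V. \<forall>\<phi>\<in>\<Phi>. cmod (\<phi> w - \<phi> v) < e} \<subseteq> S"
proof -
  have "generate_topology_on {{v\<in>V. \<phi> v \<in> U} | \<phi> U. \<phi> \<in> normed_dual V N \<and> open U} S"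
    using assms(1) unfolding weak_topology_def by (rule openin_topology_generated_by)
  then show ?thesis using assms(2)
  proof induction
    case (Int S T)
    then have v: "v \<in> S" "v \<in> T" by auto
    obtain \<Phi> d where 1: "finite \<Phi>" "\<Phi> \<subseteq> normed_dual V N" "d > 0"
        "{w\<in>V. \<forall>\<phi>\<in>\<Phi>. cmod (\<phi> w - \<phi> v) < d} \<subseteq> S"
      using Int.IH(1) [OF v(1)] by blast
    obtain \<Psi> e where 2: "finite \<Psi>" "\<Psi> \<subseteq> normed_dual V N" "e > 0"
        "{w\<in>V. \<forall>\<phi>\<in>\<Psi>. cmod (\<phi> w - \<phi> v) < e} \<subseteq> T"
      using Int.IH(2) [OF v(2)] by blast
    from 1 2 show ?case
      by (intro exI [of _ "\<Phi> \<union> \<Psi>"] exI [of _ "min d e"]) auto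
  next
    case (UN \<U>)
    then show ?case by (meson UnionE Union_upper order_trans)
  next
    case (Basis S)
    then obtain \<phi> U where \<phi>: "S = {v\<in>V. \<phi> v \<in> U}" "\<phi> \<in> normed_dual V N" "open U" by blast
    then obtain e where "e > 0" "ball (\<phi> v) e \<subseteq> U"
      using Basis.prems openE by blast
    then show ?case using \<phi>
      by (intro exI [of _ "{\<phi>}"] exI [of _ e]) (auto simp: dist_norm norm_minus_commute subset_iff)
  qed simp
qed

lemma normed_dualD:
  assumes "csubspace V" "\<phi> \<in> normed_dual V N"
  shows normed_dual_add: "u \<in> V \<Longrightarrow> v \<in> V \<Longrightarrow> \<phi> (u + v) = \<phi> u + \<phi> v"
    and normed_dual_scale: "u \<in> V \<Longrightarrow> \<phi> (c *\<^sub>C u) = c * \<phi> u"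
    and normed_dual_diff: "u \<in> V \<Longrightarrow> v \<in> V \<Longrightarrow> \<phi> (u - v) = \<phi> u - \<phi> v"
    and normed_dual_sum: "(\<And>i. i \<in> I \<Longrightarrow> f i \<in> V) \<Longrightarrow> \<phi> (\<Sum>i\<in>I. f i) = (\<Sum>i\<in>I. \<phi> (f i))"
proof -
  show add: "\<phi> (u + v) = \<phi> u + \<phi> v" if "u \<in> V" "v \<in> V" for u v
    using assms that by (simp add: normed_dual_def)
  show scale: "\<phi> (c *\<^sub>C u) = c * \<phi> u" if "u \<in> V" for u c
    using assms that by (simp add: normed_dual_def)
  show "\<phi> (u - v) = \<phi> u - \<phi> v" if "u \<in> V" "v \<in> V"
    using add [of u "- v"] scale [of v "-1"] that assms(1) complex_vector.subspace_neg [of V v] by simp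
  have zero: "\<phi> 0 = 0"
    using scale [of 0 0] assms(1) by (simp add: complex_vector.subspace_0)
  show "(\<And>i. i \<in> I \<Longrightarrow> f i \<in> V) \<Longrightarrow> \<phi> (\<Sum>i\<in>I. f i) = (\<Sum>i\<in>I. \<phi> (f i))"
    by (induction I rule: infinite_finite_induct)
      (auto simp: zero add complex_vector.subspace_sum [OF assms(1)])
qed

lemma cnj_sgn_mult: "cnj (sgn z) * z = of_real (cmod z)"
proof -
  have "z * cnj z = of_real (cmod z) * of_real (cmod z)"
    using complex_norm_square [of z] by (simp add: power2_eq_square)
  then show ?thesis by (cases "z = 0") (simp_all add: sgn_eq field_simps)
qed

text \<open>Coefficients of modulus at most one rotate all \<open>\<phi> (z i)\<close> onto the
  nonnegative axis, so the sum of moduli is the value of \<open>\<phi>\<close> at one linear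
  combination.\<close>

lemma sum_norm_functional_le:
  assumes V: "csubspace V" and \<phi>: "\<phi> \<in> normed_dual V N" and le: "\<And>u. u \<in> V \<Longrightarrow> cmod (\<phi> u) \<le> C * N u"
    and "C \<ge> 0" and z: "\<And>i. i \<in> I \<Longrightarrow> z i \<in> V"
    and B: "\<And>c. (\<And>i. cmod (c i) \<le> 1) \<Longrightarrow> N (\<Sum>i\<in>I. c i *\<^sub>C z i) \<le> B"
  shows "(\<Sum>i\<in>I. cmod (\<phi> (z i))) \<le> C * B"
proof -
  define c where "c i = cnj (sgn (\<phi> (z i)))" for i
  have "c i * \<phi> (z i) = of_real (cmod (\<phi> (z i)))" for i
    unfolding c_def by (rule cnj_sgn_mult)
  then have "of_real (\<Sum>i\<in>I. cmod (\<phi> (z i))) = (\<Sum>i\<in>I. c i * \<phi> (z i))" by simp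
  also have "\<dots> = \<phi> (\<Sum>i\<in>I. c i *\<^sub>C z i)"
    using normed_dual_sum [OF V \<phi>, of I "\<lambda>i. c i *\<^sub>C z i"] z V
    by (simp add: normed_dual_scale [OF V \<phi>] complex_vector.subspace_scale)
  finally have "cmod (of_real (\<Sum>i\<in>I. cmod (\<phi> (z i)))) = cmod (\<phi> (\<Sum>i\<in>I. c i *\<^sub>C z i))" by simp
  also have "\<dots> \<le> C * N (\<Sum>i\<in>I. c i *\<^sub>C z i)"
    using z V by (intro le complex_vector.subspace_sum complex_vector.subspace_scale)
  also have "\<dots> \<le> C * B"
    using \<open>C \<ge> 0\<close> by (intro mult_left_mono B) (simp_all add: c_def norm_sgn)
  finally show ?thesis unfolding norm_of_real by linarith
qed

lemma finite_disjoint_neighbourhoods: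
  fixes S :: "'a::t2_space set"
  assumes "finite S"
  obtains U where "\<And>x. x \<in> S \<Longrightarrow> open (U x) \<and> x \<in> U x"
    "\<And>x y. x \<in> S \<Longrightarrow> y \<in> S \<Longrightarrow> x \<noteq> y \<Longrightarrow> U x \<inter> U y = {}"
proof -
  have "\<forall>x y::'a. \<exists>W W'. x \<noteq> y \<longrightarrow> open W \<and> open W' \<and> x \<in> W \<and> y \<in> W' \<and> W \<inter> W' = {}"
    by (metis hausdorff)
  then have "\<exists>W W'. \<forall>x y::'a. x \<noteq> y \<longrightarrow>
      open (W x y) \<and> open (W' x y) \<and> x \<in> W x y \<and> y \<in> W' x y \<and> W x y \<inter> W' x y = {}"
    by (simp only: choice_iff)
  then obtain W W' where W: "\<And>x y::'a. x \<noteq> y \<Longrightarrow>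
      open (W x y) \<and> open (W' x y) \<and> x \<in> W x y \<and> y \<in> W' x y \<and> W x y \<inter> W' x y = {}" by blast
  \<comment> \<open>Each \<open>x\<close> occurs both as first and as second point of a pair, so
    both kinds of separating sets are intersected.\<close>
  define U where "U x = (\<Inter>y\<in>S-{x}. W x y \<inter> W' y x)" for x
  have "open (U x) \<and> x \<in> U x" if "x \<in> S" for x
    using W assms unfolding U_def by (intro conjI open_INT ballI open_Int INT_I IntI) (metis DiffE finite_Diff insertCI)+
  moreover have "U x \<inter> U y = {}" if "x \<in> S" "y \<in> S" "x \<noteq> y" for x y
  proof -
    have "U x \<subseteq> W x y" "U y \<subseteq> W' x y" using that by (auto simp: U_def)
    then show ?thesis using W [OF that(3)] by blast
  qed
  ultimately show thesis by (rule that)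
qed

text \<open>The point \<open>r\<close> lies in at most one of the sets, so all terms but one are at
  most \<open>e\<close>.\<close>

lemma sum_le_disjoint:
  fixes v :: "'i \<Rightarrow> real" and c e :: real
  assumes "finite S" and disj: "\<And>x y. x \<in> S \<Longrightarrow> y \<in> S \<Longrightarrow> x \<noteq> y \<Longrightarrow> U x \<inter> U y = {}"
    and "c \<ge> 0" "e \<ge> 0" and c: "\<And>x. x \<in> S \<Longrightarrow> v x \<le> c"
    and e: "\<And>x. x \<in> S \<Longrightarrow> r \<notin> U x \<Longrightarrow> v x \<le> e"
  shows "sum v S \<le> c + card S * e"
proof (cases "\<exists>x\<in>S. r \<in> U x")
  case True
  then obtain x where x: "x \<in> S" "r \<in> U x" by blast
  have "sum v S = v x + sum v (S - {x})" using x assms(1) by (simp add: sum.remove)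
  also have "sum v (S - {x}) \<le> (\<Sum>y\<in>S - {x}. e)" using disj x by (intro sum_mono e) auto
  also have "(\<Sum>y\<in>S - {x}. e) \<le> (\<Sum>y\<in>S. e)" using assms by (intro sum_mono2) auto
  finally show ?thesis using c [OF x(1)] by simp
next
  case False
  then have "sum v S \<le> (\<Sum>y\<in>S. e)" by (intro sum_mono e) auto
  then show ?thesis using \<open>c \<ge> 0\<close> by simp
qed

text \<open>\<open>norming\<close> is only approximate because functionals from a predual need not
  attain the norm. \<open>nonvanishing\<close> provides elements of \<open>F\<close> that can be cut
  off near any point of \<open>\<Gamma>\<close>.\<close>

locale function_module = separating_algebra A for A :: "('k::t2_space \<Rightarrow> complex) set" +
  fixes F :: "('k \<Rightarrow> 'x::complex_normed_vector) set"
  assumes subspace: "csubspace F"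
    and module: "a \<in> A \<Longrightarrow> f \<in> F \<Longrightarrow> (\<lambda>t. a t *\<^sub>C f t) \<in> F"
    and bounded: "f \<in> F \<Longrightarrow> bdd_above (range (\<lambda>t. norm (f t)))"
    and norming: "f \<in> F \<Longrightarrow> e > 0 \<Longrightarrow>
      \<exists>\<psi>. \<psi> \<circ> f \<in> A \<and> (\<forall>x. cmod (\<psi> x) \<le> norm x) \<and> norm (f s) - e \<le> cmod (\<psi> (f s))"
    and nonvanishing: "\<exists>f\<in>F. \<forall>t. f t \<noteq> 0"
    and infinite_\<Gamma>: "infinite \<Gamma>"
begin

lemma norm_le_sup_norm: "f \<in> F \<Longrightarrow> norm (f t) \<le> sup_norm f"
  unfolding sup_norm_def using bounded by (intro cSUP_upper) auto

text \<open>A nearly norming functional turns \<open>f\<close> into an element of \<open>A\<close>,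
  which attains its maximum modulus on \<open>\<Gamma>\<close>.\<close>

lemma sup_norm_le:
  assumes f: "f \<in> F" and le: "\<And>t. t \<in> \<Gamma> \<Longrightarrow> norm (f t) \<le> c"
  shows "sup_norm f \<le> c"
  unfolding sup_norm_def
proof (rule cSUP_least)
  fix s
  show "norm (f s) \<le> c"
  proof (rule field_le_epsilon)
    fix e :: real assume "e > 0"
    then obtain \<psi> where \<psi>: "\<psi> \<circ> f \<in> A" "\<And>x. cmod (\<psi> x) \<le> norm x" "norm (f s) - e \<le> cmod (\<psi> (f s))"
      using norming [OF f] by blast
    obtain t where t: "t \<in> \<Gamma>" "\<And>s. cmod ((\<psi> \<circ> f) s) \<le> cmod ((\<psi> \<circ> f) t)"
      using norming_on_\<Gamma> [OF \<psi>(1)] by blast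
    have "norm (f s) - e \<le> cmod (\<psi> (f t))" using \<psi>(3) t(2) [of s] by simp
    also have "\<dots> \<le> c" using \<psi>(2) le [OF t(1)] order_trans by blast
    finally show "norm (f s) \<le> c + e" by simp
  qed
qed simp

lemma F_add: "f \<in> F \<Longrightarrow> g \<in> F \<Longrightarrow> f + g \<in> F"
  and F_diff: "f \<in> F \<Longrightarrow> g \<in> F \<Longrightarrow> f - g \<in> F"
  and F_scale: "f \<in> F \<Longrightarrow> c *\<^sub>C f \<in> F"
  using subspace by (auto intro: complex_vector.subspace_add complex_vector.subspace_diff complex_vector.subspace_scale)

text \<open>The nowhere vanishing element of \<open>F\<close> is rescaled by its supremum over \<open>\<Gamma> \<inter> U\<close> and cut off by a
  function that peaks where this supremum is almost attained. Its norm need not be continuous on \<open>K\<close>,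
  so it could not be controlled near a prescribed point.\<close>

lemma local_peak:
  assumes U: "open U" and t: "t \<in> \<Gamma> \<inter> U" and e: "0 < e" "e < 1"
  obtains b y s where "b \<in> A" "y \<in> F" "\<And>r. cmod (b r) \<le> 1 + e"
    "\<And>r. r \<in> \<Gamma> \<Longrightarrow> cmod (1 - b r) + norm (y r) \<le> 1 + 2 * e"
    "\<And>r. r \<notin> U \<Longrightarrow> cmod (b r) \<le> e" "\<And>r. r \<notin> U \<Longrightarrow> norm (y r) \<le> e"
    "norm (y s) \<ge> (1 - e)\<^sup>2"
proof -
  obtain p where p: "p \<in> F" "\<And>t. p t \<noteq> 0" using nonvanishing by blast
  define M where "M = (SUP r\<in>\<Gamma> \<inter> U. norm (p r))"
  have bdd: "bdd_above ((\<lambda>r. norm (p r)) ` (\<Gamma> \<inter> U))"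
    using bounded [OF p(1)] by (rule bdd_above_mono) auto
  have le_M: "norm (p r) \<le> M" if "r \<in> \<Gamma> \<inter> U" for r
    unfolding M_def using bdd that by (intro cSUP_upper)
  have "M > 0" using le_M [OF t] p(2) [of t] by (smt (verit) zero_less_norm_iff)
  have "(1 - e) * M < M" using e \<open>M > 0\<close> by simp
  then obtain s where s: "s \<in> \<Gamma> \<inter> U" "(1 - e) * M < norm (p s)"
    unfolding M_def using less_cSUP_iff [OF _ bdd] t by (metis empty_iff)
  define P where "P = sup_norm p"
  have P: "norm (p r) \<le> P" for r using norm_le_sup_norm [OF p(1)] by (simp add: P_def)
  have "P > 0" using P [of t] p(2) [of t] by (smt (verit) zero_less_norm_iff)
  \<comment> \<open>The second bound compensates for \<open>p\<close> being larger outside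
    \<open>U\<close> than \<open>M\<close>: there \<open>norm (y r)\<close> is at most
    \<open>d * P / M\<close>.\<close>
  define d where "d = min e (e * M / P)"
  have d: "d > 0" "d \<le> e" "d * P \<le> e * M"
    using e \<open>M > 0\<close> \<open>P > 0\<close> by (auto simp: d_def min_def field_simps)
  obtain b where b: "b \<in> A" "cmod (b s - 1) \<le> d" "\<And>r. cmod (b r) + cmod (1 - b r) \<le> 1 + d"
      "\<And>r. r \<notin> U \<Longrightarrow> cmod (b r) \<le> d"
    using stolz_peak [of s U d] s U d(1) by auto
  define y where "y r = of_real (inverse M) *\<^sub>C b r *\<^sub>C p r" for r
  have y_eq: "norm (y r) = cmod (b r) * norm (p r) / M" for r
    using \<open>M > 0\<close> by (simp add: y_def norm_scaleC norm_mult norm_inverse divide_inverse mult_ac)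
  show thesis
  proof (rule that)
    show "b \<in> A" by (fact b(1))
    show "y \<in> F"
      using F_scale [OF module [OF b(1) p(1)], of "of_real (inverse M)"]
      by (simp add: y_def [abs_def] scaleC_fun_def)
    show "cmod (b r) \<le> 1 + e" for r using b(3) [of r] d(2) norm_ge_zero [of "1 - b r"] by linarith
    show out: "norm (y r) \<le> e" if "r \<notin> U" for r
    proof -
      have "cmod (b r) * norm (p r) \<le> d * P"
        using b(4) [OF that] P d(1) by (intro mult_mono) auto
      then show ?thesis using d(3) \<open>M > 0\<close> by (simp add: y_eq divide_le_eq)
    qed
    show "cmod (b r) \<le> e" if "r \<notin> U" for r using b(4) [OF that] d(2) by simp
    show "cmod (1 - b r) + norm (y r) \<le> 1 + 2 * e" if "r \<in> \<Gamma>" for r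
    proof (cases "r \<in> U")
      case True
      then have "cmod (b r) * norm (p r) \<le> cmod (b r) * M"
        using that by (intro mult_left_mono le_M) auto
      then have "norm (y r) \<le> cmod (b r)" using \<open>M > 0\<close> by (simp add: y_eq divide_le_eq)
      then show ?thesis using b(3) [of r] d(2) e by linarith
    next
      case False
      then show ?thesis using b(3) [of r] out [of r] d(2) norm_ge_zero [of "b r"] by linarith
    qed
    \<comment> \<open>One factor \<open>1 - e\<close> comes from \<open>b\<close> at
      \<open>s\<close>, the other from the choice of \<open>s\<close> with \<open>norm (p s)\<close>
      close to \<open>M\<close>.\<close>
    have "1 - e \<le> cmod (b s)"
      using norm_triangle_ineq2 [of 1 "1 - b s"] b(2) d(2) by (simp add: norm_minus_commute)
    then have "(1 - e) * ((1 - e) * M) \<le> cmod (b s) * norm (p s)"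
      using s(2) e \<open>M > 0\<close> by (intro mult_mono) auto
    then show "norm (y s) \<ge> (1 - e)\<^sup>2"
      using \<open>M > 0\<close> by (simp add: y_eq le_divide_eq power2_eq_square mult.assoc)
  qed
qed

text \<open>A pigeonhole argument: over \<open>m\<close> disjoint open sets the functionals in
  \<open>\<Phi>\<close> have total mass at most \<open>D\<close> on the bumps, so for
  \<open>m > 2 * D / e\<close> some bump has mass below \<open>e / 2\<close>.\<close>

lemma antipodal_pair:
  assumes f: "f \<in> F" "sup_norm f \<le> 1" and \<Phi>: "finite \<Phi>" "\<Phi> \<subseteq> normed_dual F sup_norm"
    and "e > 0" "d > 0"
  obtains g h where "g \<in> F" "h \<in> F" "sup_norm g \<le> 1" "sup_norm h \<le> 1"
    "\<And>\<phi>. \<phi> \<in> \<Phi> \<Longrightarrow> cmod (\<phi> g - \<phi> f) < e" "\<And>\<phi>. \<phi> \<in> \<Phi> \<Longrightarrow> cmod (\<phi> h - \<phi> f) < e"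
    "2 - d \<le> sup_norm (g - h)"
proof -
  have sup_norm_nonneg: "0 \<le> sup_norm u" if "u \<in> F" for u
    using norm_le_sup_norm [OF that, of undefined] by (meson norm_ge_zero order_trans)
  have "\<forall>\<phi>\<in>\<Phi>. \<exists>C. \<forall>u\<in>F. cmod (\<phi> u) \<le> C * sup_norm u"
    using \<Phi>(2) by (auto simp: normed_dual_def)
  then obtain Cf where Cf: "\<And>\<phi> u. \<phi> \<in> \<Phi> \<Longrightarrow> u \<in> F \<Longrightarrow> cmod (\<phi> u) \<le> Cf \<phi> * sup_norm u" by metis
  define C where "C = 1 + (\<Sum>\<phi>\<in>\<Phi>. \<bar>Cf \<phi>\<bar>)"
  have "C \<ge> 1" by (simp add: C_def sum_nonneg)
  have C: "cmod (\<phi> u) \<le> C * sup_norm u" if "\<phi> \<in> \<Phi>" "u \<in> F" for \<phi> u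
  proof -
    have "Cf \<phi> \<le> C" using member_le_sum [OF that(1), of "\<lambda>\<phi>. \<bar>Cf \<phi>\<bar>"] \<Phi>(1) by (simp add: C_def)
    then show ?thesis
      using Cf [OF that] mult_right_mono [OF _ sup_norm_nonneg [OF that(2)]] order_trans by blast
  qed
  \<comment> \<open>For each functional, the families \<open>w\<close> and \<open>y\<close>
    contribute at most \<open>4 * C\<close> each.\<close>
  define D where "D = 8 * C * card \<Phi>"
  have "D \<ge> 0" using \<open>C \<ge> 1\<close> by (simp add: D_def)
  obtain m :: nat where m: "2 * D / e < m" using reals_Archimedean2 by blast
  have "m > 0" using m \<open>D \<ge> 0\<close> \<open>e > 0\<close> by (auto intro!: Nat.gr0I simp: field_simps)
  obtain S where S: "S \<subseteq> \<Gamma>" "finite S" "card S = m"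
    using infinite_\<Gamma> by (meson infinite_arbitrarily_large)
  obtain U where U: "\<And>x. x \<in> S \<Longrightarrow> open (U x) \<and> x \<in> U x"
    and disj: "\<And>x y. x \<in> S \<Longrightarrow> y \<in> S \<Longrightarrow> x \<noteq> y \<Longrightarrow> U x \<inter> U y = {}"
    using finite_disjoint_neighbourhoods [OF S(2)] by blast
  \<comment> \<open>The bound \<open>1 / m\<close> keeps the sum of the \<open>m\<close> tails at
    most 1, \<open>e / (8 * C)\<close> absorbs the later normalization, and \<open>d / 8\<close> the
    loss in distance.\<close>
  define \<epsilon> where "\<epsilon> = min (min (1 / m) (1 / 2)) (min (e / (8 * C)) (d / 8))"
  have \<epsilon>: "0 < \<epsilon>" "m * \<epsilon> \<le> 1" "\<epsilon> \<le> 1 / 2" "8 * \<epsilon> * C \<le> e" "8 * \<epsilon> \<le> d"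
  proof -
    show "0 < \<epsilon>" using \<open>m > 0\<close> \<open>e > 0\<close> \<open>d > 0\<close> \<open>C \<ge> 1\<close> by (simp add: \<epsilon>_def)
    have "\<epsilon> \<le> 1 / m" "\<epsilon> \<le> e / (8 * C)" by (auto simp: \<epsilon>_def)
    then show "m * \<epsilon> \<le> 1" "8 * \<epsilon> * C \<le> e" using \<open>m > 0\<close> \<open>C \<ge> 1\<close> by (simp_all add: field_simps)
    show "\<epsilon> \<le> 1 / 2" "8 * \<epsilon> \<le> d" by (auto simp: \<epsilon>_def)
  qed
  have "\<forall>x\<in>S. \<exists>b y. b \<in> A \<and> y \<in> F \<and> (\<forall>r. cmod (b r) \<le> 1 + \<epsilon>) \<and>
      (\<forall>r\<in>\<Gamma>. cmod (1 - b r) + norm (y r) \<le> 1 + 2 * \<epsilon>) \<and>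
      (\<forall>r. r \<notin> U x \<longrightarrow> cmod (b r) \<le> \<epsilon> \<and> norm (y r) \<le> \<epsilon>) \<and> (\<exists>s. norm (y s) \<ge> (1 - \<epsilon>)\<^sup>2)"
  proof
    fix x assume "x \<in> S"
    then have "open (U x)" "x \<in> \<Gamma> \<inter> U x" "\<epsilon> < 1" using U S(1) \<epsilon>(3) by auto
    then show "\<exists>b y. b \<in> A \<and> y \<in> F \<and> (\<forall>r. cmod (b r) \<le> 1 + \<epsilon>) \<and>
      (\<forall>r\<in>\<Gamma>. cmod (1 - b r) + norm (y r) \<le> 1 + 2 * \<epsilon>) \<and>
      (\<forall>r. r \<notin> U x \<longrightarrow> cmod (b r) \<le> \<epsilon> \<and> norm (y r) \<le> \<epsilon>) \<and> (\<exists>s. norm (y s) \<ge> (1 - \<epsilon>)\<^sup>2)"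
      by (rule local_peak [OF _ _ \<epsilon>(1)]) blast
  qed
  then obtain b y where bump: "\<And>x. x \<in> S \<Longrightarrow> b x \<in> A \<and> y x \<in> F \<and> (\<forall>r. cmod (b x r) \<le> 1 + \<epsilon>) \<and>
      (\<forall>r\<in>\<Gamma>. cmod (1 - b x r) + norm (y x r) \<le> 1 + 2 * \<epsilon>) \<and>
      (\<forall>r. r \<notin> U x \<longrightarrow> cmod (b x r) \<le> \<epsilon> \<and> norm (y x r) \<le> \<epsilon>) \<and> (\<exists>s. norm (y x s) \<ge> (1 - \<epsilon>)\<^sup>2)"
    by metis
  define w where "w x = (\<lambda>r. b x r *\<^sub>C f r)" for x
  have wF: "w x \<in> F" if "x \<in> S" for x unfolding w_def using bump [OF that] f by (intro module) auto
  have norm_f: "norm (f r) \<le> 1" for r using norm_le_sup_norm [OF f(1), of r] f(2) by simp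
  have norm_w: "norm (w x r) \<le> cmod (b x r)" for x r
    using norm_f [of r] by (simp add: w_def norm_scaleC mult_left_le)
  have total: "(\<Sum>x\<in>S. cmod (\<phi> (z x))) \<le> C * 4"
    if \<phi>: "\<phi> \<in> \<Phi>" and z: "\<And>x. x \<in> S \<Longrightarrow> z x \<in> F" "\<And>x r. x \<in> S \<Longrightarrow> r \<in> \<Gamma> \<Longrightarrow> norm (z x r) \<le> 1 + 2 * \<epsilon>"
      "\<And>x r. x \<in> S \<Longrightarrow> r \<notin> U x \<Longrightarrow> norm (z x r) \<le> \<epsilon>" for \<phi> z
  proof (rule sum_norm_functional_le [OF subspace])
    show "\<phi> \<in> normed_dual F sup_norm" using \<phi> \<Phi> by blast
    show "cmod (\<phi> u) \<le> C * sup_norm u" if "u \<in> F" for u using C \<phi> that by blast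
    show "z x \<in> F" if "x \<in> S" for x using z that by blast
    show "sup_norm (\<Sum>x\<in>S. c x *\<^sub>C z x) \<le> 4" if c: "\<And>x. cmod (c x) \<le> 1" for c
    proof (rule sup_norm_le)
      show "(\<Sum>x\<in>S. c x *\<^sub>C z x) \<in> F"
        using z subspace by (intro complex_vector.subspace_sum F_scale) auto
      fix r assume "r \<in> \<Gamma>"
      have "norm ((\<Sum>x\<in>S. c x *\<^sub>C z x) r) \<le> (\<Sum>x\<in>S. norm (z x r))"
        unfolding sum_fun_apply
        by (rule sum_norm_le) (use c in \<open>simp add: scaleC_fun_def norm_scaleC mult_left_le_one_le\<close>)
      also have "\<dots> \<le> (1 + 2 * \<epsilon>) + card S * \<epsilon>"
        using S(2) disj \<epsilon>(1) z \<open>r \<in> \<Gamma>\<close> by (intro sum_le_disjoint [where U = U and r = r]) auto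
      also have "\<dots> \<le> 4" using \<epsilon> S(3) by simp
      finally show "norm ((\<Sum>x\<in>S. c x *\<^sub>C z x) r) \<le> 4" .
    qed
  qed (use \<open>C \<ge> 1\<close> in simp)
  define q where "q x = (\<Sum>\<phi>\<in>\<Phi>. cmod (\<phi> (w x)) + cmod (\<phi> (y x)))" for x
  have "(\<Sum>x\<in>S. q x) \<le> D"
  proof -
    have w_total: "(\<Sum>x\<in>S. cmod (\<phi> (w x))) \<le> C * 4" if "\<phi> \<in> \<Phi>" for \<phi>
    proof (rule total [OF that wF])
      show "norm (w x r) \<le> 1 + 2 * \<epsilon>" if "x \<in> S" for x r
        using norm_w [of x r] bump [OF that] \<epsilon>(1) by (smt (verit))
      show "norm (w x r) \<le> \<epsilon>" if "x \<in> S" "r \<notin> U x" for x r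
        using norm_w [of x r] bump [OF that(1)] that(2) by (smt (verit))
    qed
    have y_total: "(\<Sum>x\<in>S. cmod (\<phi> (y x))) \<le> C * 4" if "\<phi> \<in> \<Phi>" for \<phi>
    proof (rule total [OF that])
      show "norm (y x r) \<le> 1 + 2 * \<epsilon>" if "x \<in> S" "r \<in> \<Gamma>" for x r
        using bump [OF that(1)] that(2) norm_ge_zero [of "1 - b x r"] by (smt (verit))
    qed (use bump in blast)+
    have "(\<Sum>x\<in>S. q x) = (\<Sum>\<phi>\<in>\<Phi>. (\<Sum>x\<in>S. cmod (\<phi> (w x))) + (\<Sum>x\<in>S. cmod (\<phi> (y x))))"
      unfolding q_def by (subst sum.swap) (simp add: sum.distrib)
    also have "\<dots> \<le> (\<Sum>\<phi>\<in>\<Phi>. C * 4 + C * 4)"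
      using w_total y_total by (intro sum_mono add_mono)
    also have "\<dots> = D" by (simp add: D_def)
    finally show ?thesis .
  qed
  moreover have "D < (\<Sum>x\<in>S. e / 2)" using m S(3) \<open>e > 0\<close> by (simp add: field_simps)
  ultimately have "\<not> (\<forall>x\<in>S. e / 2 \<le> q x)" using sum_mono [of S "\<lambda>_. e / 2" q] by fastforce
  then obtain x where x: "x \<in> S" "q x < e / 2" by force
  have small: "cmod (\<phi> (w x)) + cmod (\<phi> (y x)) < e / 2" if "\<phi> \<in> \<Phi>" for \<phi>
    using member_le_sum [OF that, of "\<lambda>\<phi>. cmod (\<phi> (w x)) + cmod (\<phi> (y x))"] \<Phi>(1) x(2)
    by (simp add: q_def)
  \<comment> \<open>The norm bound on \<open>\<Gamma>\<close> for the perturbed functions; division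
    by it returns them to the unit ball.\<close>
  define k where "k = 1 + 2 * \<epsilon>"
  have "k > 1" using \<epsilon>(1) by (simp add: k_def)
  \<comment> \<open>Here \<open>v\<close> stands for \<open>y x\<close> or its negative, so that
    both points are treated at once.\<close>
  have perturbation: "inverse (of_real k) *\<^sub>C ((f - w x) + v) \<in> F \<and>
      sup_norm (inverse (of_real k) *\<^sub>C ((f - w x) + v)) \<le> 1 \<and>
      (\<forall>\<phi>\<in>\<Phi>. cmod (\<phi> (inverse (of_real k) *\<^sub>C ((f - w x) + v)) - \<phi> f) < e)"
    if v: "v \<in> F" "\<And>r. norm (v r) = norm (y x r)" "\<And>\<phi>. \<phi> \<in> \<Phi> \<Longrightarrow> cmod (\<phi> v) = cmod (\<phi> (y x))" for v
  proof (intro conjI ballI)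
    let ?g = "inverse (of_real k) *\<^sub>C ((f - w x) + v)"
    have F: "f - w x \<in> F" "(f - w x) + v \<in> F" using f wF [OF x(1)] v by (auto intro: F_add F_diff)
    then show "?g \<in> F" by (intro F_scale)
    then show "sup_norm ?g \<le> 1"
    proof (rule sup_norm_le)
      fix r assume "r \<in> \<Gamma>"
      have "norm (f r - w x r) = cmod (1 - b x r) * norm (f r)"
        by (simp add: w_def complex_vector.scale_left_diff_distrib scaleC_one flip: norm_scaleC)
      also have "\<dots> \<le> cmod (1 - b x r)" using norm_f [of r] by (simp add: mult_left_le)
      finally have "norm ((f - w x + v) r) \<le> k"
        using norm_triangle_ineq [of "f r - w x r" "v r"] bump [OF x(1)] \<open>r \<in> \<Gamma>\<close> v(2) [of r]
        unfolding k_def by (simp add: fun_diff_def) (smt (verit))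
      moreover have "norm (?g r) = norm ((f - w x + v) r) / k"
        using \<open>k > 1\<close> unfolding scaleC_fun_def norm_scaleC norm_inverse by (simp add: divide_inverse)
      ultimately show "norm (?g r) \<le> 1" using \<open>k > 1\<close> by simp
    qed
    fix \<phi> assume "\<phi> \<in> \<Phi>"
    then have \<phi>: "\<phi> \<in> normed_dual F sup_norm" using \<Phi> by blast
    define G where "G = \<phi> ?g"
    have "G = inverse (of_real k) * (\<phi> f - \<phi> (w x) + \<phi> v)"
      unfolding G_def using F f(1) v(1) wF [OF x(1)] by (simp only: normed_dualD [OF subspace \<phi>])
    then have "of_real k * G = \<phi> f - \<phi> (w x) + \<phi> v" using \<open>k > 1\<close> by simp
    \<comment> \<open>Multiplying by \<open>k\<close> leaves the normalization visible only through
      \<open>k - 1 = 2 * \<epsilon>\<close>.\<close>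
    then have "of_real k * (G - \<phi> f) = \<phi> v - \<phi> (w x) - of_real (2 * \<epsilon>) * \<phi> f"
      by (simp add: k_def algebra_simps)
    then have "cmod (of_real k * (G - \<phi> f)) = cmod (\<phi> v - \<phi> (w x) - of_real (2 * \<epsilon>) * \<phi> f)"
      by simp
    then have "k * cmod (\<phi> ?g - \<phi> f) = cmod (\<phi> v - \<phi> (w x) - of_real (2 * \<epsilon>) * \<phi> f)"
      using \<open>k > 1\<close> unfolding norm_mult norm_of_real G_def by simp
    also have "\<dots> \<le> cmod (\<phi> v) + cmod (\<phi> (w x)) + 2 * \<epsilon> * cmod (\<phi> f)"
      using norm_triangle_ineq4 [of "\<phi> v - \<phi> (w x)" "of_real (2 * \<epsilon>) * \<phi> f"]
        norm_triangle_ineq4 [of "\<phi> v" "\<phi> (w x)"] \<epsilon>(1) by (simp add: norm_mult)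
    also have "\<dots> < e / 2 + 2 * \<epsilon> * C"
    proof -
      have "cmod (\<phi> f) \<le> C * sup_norm f" using C \<open>\<phi> \<in> \<Phi>\<close> f by blast
      also have "\<dots> \<le> C" using f(2) \<open>C \<ge> 1\<close> by (simp add: mult_left_le)
      finally have "2 * \<epsilon> * cmod (\<phi> f) \<le> 2 * \<epsilon> * C" using \<epsilon>(1) by (intro mult_left_mono) auto
      then show ?thesis using small [OF \<open>\<phi> \<in> \<Phi>\<close>] v(3) [OF \<open>\<phi> \<in> \<Phi>\<close>] by linarith
    qed
    also have "\<dots> < e" using \<epsilon>(4) \<open>e > 0\<close> by linarith
    finally have "k * cmod (\<phi> ?g - \<phi> f) < e" .
    moreover have "1 * cmod (\<phi> ?g - \<phi> f) \<le> k * cmod (\<phi> ?g - \<phi> f)"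
      using \<open>k > 1\<close> by (intro mult_right_mono) auto
    ultimately show "cmod (\<phi> ?g - \<phi> f) < e" by linarith
  qed
  define g where "g = inverse (of_real k) *\<^sub>C ((f - w x) + y x)"
  define h where "h = inverse (of_real k) *\<^sub>C ((f - w x) + (-1) *\<^sub>C y x)"
  have yF: "y x \<in> F" using bump x by blast
  have g: "g \<in> F \<and> sup_norm g \<le> 1 \<and> (\<forall>\<phi>\<in>\<Phi>. cmod (\<phi> g - \<phi> f) < e)"
    unfolding g_def using yF by (intro perturbation) auto
  have h: "h \<in> F \<and> sup_norm h \<le> 1 \<and> (\<forall>\<phi>\<in>\<Phi>. cmod (\<phi> h - \<phi> f) < e)"
    unfolding h_def
  proof (rule perturbation)
    show "cmod (\<phi> ((-1) *\<^sub>C y x)) = cmod (\<phi> (y x))" if "\<phi> \<in> \<Phi>" for \<phi>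
      using normed_dual_scale [OF subspace _ yF, of \<phi> sup_norm "-1"] that \<Phi>(2) by (auto simp: subset_iff)
    show "(-1) *\<^sub>C y x \<in> F" using F_scale yF by blast
  qed (simp add: scaleC_fun_def norm_scaleC)
  obtain s where s: "(1 - \<epsilon>)\<^sup>2 \<le> norm (y x s)" using bump x by blast
  have "(g - h) s = inverse (of_real k) *\<^sub>C 2 *\<^sub>C y x s"
  proof -
    have "(2::complex) *\<^sub>C y x s = y x s + y x s"
      using scaleC_add_left [of 1 1 "y x s"] by (simp add: scaleC_one)
    then show ?thesis
      by (simp add: g_def h_def fun_diff_def scaleC_fun_def complex_vector.scale_right_diff_distrib scaleC_add_right)
  qed
  then have "norm ((g - h) s) = 2 * norm (y x s) / k"
    using \<open>k > 1\<close> by (simp only: norm_scaleC norm_inverse) (simp add: divide_inverse)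
  moreover have "(2 - d) * k \<le> 2 * (1 - \<epsilon>)\<^sup>2"
  proof -
    have "(2 - d) * k \<le> (2 - 8 * \<epsilon>) * k" using \<epsilon>(5) \<open>k > 1\<close> by (intro mult_right_mono) auto
    \<comment> \<open>The product expands to
      \<open>2 - 4 * \<epsilon> - 16 * \<epsilon>\<^sup>2\<close>, the right-hand side to
      \<open>2 - 4 * \<epsilon> + 2 * \<epsilon>\<^sup>2\<close>.\<close>
    also have "\<dots> \<le> 2 * (1 - \<epsilon>)\<^sup>2" by (simp add: k_def power2_eq_square algebra_simps)
    finally show ?thesis .
  qed
  ultimately have "2 - d \<le> norm ((g - h) s)"
    using s \<open>k > 1\<close> by (simp add: le_divide_eq)
  also have "\<dots> \<le> sup_norm (g - h)" using g h by (intro norm_le_sup_norm F_diff) auto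
  finally show thesis using that g h by blast
qed

lemma diameter_two: "diameter_two_property F sup_norm"
  unfolding diameter_two_property_def
proof (intro allI impI, elim conjE)
  fix W assume "openin (subtopology (weak_topology F sup_norm) {v \<in> F. sup_norm v \<le> 1}) W" "W \<noteq> {}"
  then obtain T f where T: "openin (weak_topology F sup_norm) T" "W = T \<inter> {v \<in> F. sup_norm v \<le> 1}"
    and f: "f \<in> T" "f \<in> F" "sup_norm f \<le> 1"
    by (auto simp: openin_subtopology)
  obtain \<Phi> e where \<Phi>: "finite \<Phi>" "\<Phi> \<subseteq> normed_dual F sup_norm" "e > 0"
      "{w\<in>F. \<forall>\<phi>\<in>\<Phi>. cmod (\<phi> w - \<phi> f) < e} \<subseteq> T"
    using weak_topology_neighbourhood [OF T(1) f(1)] by blast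
  let ?N = "\<lambda>(u, v). sup_norm (u - v)"
  have le: "?N p \<le> 2" if "p \<in> W \<times> W" for p
  proof -
    obtain u v where p: "p = (u, v)" "u \<in> W" "v \<in> W" using \<open>p \<in> W \<times> W\<close> by blast
    then have "u \<in> F" "v \<in> F" "sup_norm u \<le> 1" "sup_norm v \<le> 1" using T by auto
    moreover have "sup_norm (u - v) \<le> 2"
    proof (rule sup_norm_le)
      fix t
      show "norm ((u - v) t) \<le> 2"
        using norm_triangle_ineq4 [of "u t" "v t"] norm_le_sup_norm [of u t] norm_le_sup_norm [of v t] calculation
        by (simp add: fun_diff_def)
    qed (use calculation in \<open>intro F_diff\<close>)
    ultimately show ?thesis using p by simp
  qed
  have "(SUP p\<in>W \<times> W. ?N p) = 2"
  proof (rule antisym)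
    show "(SUP p\<in>W \<times> W. ?N p) \<le> 2" using \<open>W \<noteq> {}\<close> le by (intro cSUP_least) auto
    show "2 \<le> (SUP p\<in>W \<times> W. ?N p)"
    proof (rule field_le_epsilon)
      fix d :: real assume "d > 0"
      obtain g h where gh: "g \<in> F" "h \<in> F" "sup_norm g \<le> 1" "sup_norm h \<le> 1"
        "\<And>\<phi>. \<phi> \<in> \<Phi> \<Longrightarrow> cmod (\<phi> g - \<phi> f) < e" "\<And>\<phi>. \<phi> \<in> \<Phi> \<Longrightarrow> cmod (\<phi> h - \<phi> f) < e"
        "2 - d \<le> sup_norm (g - h)"
        using antipodal_pair [OF f(2,3) \<Phi>(1-3) \<open>d > 0\<close>] by blast
      then have "g \<in> W" "h \<in> W" using \<Phi>(4) T(2) by auto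
      then have "?N (g, h) \<le> (SUP p\<in>W \<times> W. ?N p)"
        using le by (intro cSUP_upper bdd_aboveI2 [of _ _ 2]) auto
      then show "2 \<le> (SUP p\<in>W \<times> W. ?N p) + d" using gh(7) by simp
    qed
  qed
  then show "norm_diameter sup_norm W = 2" using \<open>W \<noteq> {}\<close> by (simp add: norm_diameter_def)
qed

end

section \<open>Norming duals of compatible topologies\<close>

text \<open>The complex functional with real part \<open>u\<close> maps \<open>z\<close> to
  \<open>u z - \<i> * u (\<i> *\<^sub>C z)\<close>. It keeps the bound \<open>C\<close>, since
  rotating \<open>z\<close> makes its value real and nonnegative.\<close>

lemma complexified_functional:
  fixes u :: "'x::complex_normed_vector \<Rightarrow> real"
  assumes u: "linear u" and le: "\<And>z. \<bar>u z\<bar> \<le> C * norm z"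
  obtains \<phi> where "\<phi> \<in> normed_dual UNIV norm" "\<And>z. cmod (\<phi> z) \<le> C * norm z" "\<And>z. Re (\<phi> z) = u z"
proof -
  define \<phi> where "\<phi> z = Complex (u z) (- u (\<i> *\<^sub>C z))" for z
  have add: "\<phi> (x + y) = \<phi> x + \<phi> y" for x y
    using u by (simp add: \<phi>_def complex_eq_iff linear_add scaleC_add_right)
  have scale: "\<phi> (c *\<^sub>C z) = c * \<phi> z" for c z
  proof -
    have 1: "c *\<^sub>C z = Re c *\<^sub>R z + Im c *\<^sub>R \<i> *\<^sub>C z"
      using scaleC_add_left [of "of_real (Re c)" "of_real (Im c) * \<i>" z]
      by (simp add: scaleR_scaleC scaleC_scaleC complex_eq mult.commute flip: complex_eq)
    have 2: "\<i> *\<^sub>C c *\<^sub>C z = Re c *\<^sub>R \<i> *\<^sub>C z + (- Im c) *\<^sub>R z"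
    proof -
      have "\<i> * c = of_real (Re c) * \<i> + of_real (- Im c)" by (simp add: complex_eq_iff)
      then show ?thesis by (simp only: scaleR_scaleC scaleC_scaleC flip: scaleC_add_left)
    qed
    show ?thesis
      unfolding \<phi>_def 2 unfolding 1 using u by (simp add: complex_eq_iff linear_add linear_diff linear_scale)
  qed
  have bound: "cmod (\<phi> z) \<le> C * norm z" for z
  proof -
    let ?c = "cnj (sgn (\<phi> z))"
    have "cmod (\<phi> z) = Re (\<phi> (?c *\<^sub>C z))" using cnj_sgn_mult [of "\<phi> z"] by (simp add: scale)
    also have "\<dots> \<le> C * norm (?c *\<^sub>C z)" using le [of "?c *\<^sub>C z"] by (simp add: \<phi>_def)
    also have "\<dots> \<le> C * norm z"
    proof (cases "\<phi> z = 0")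
      \<comment> \<open>Now \<open>?c\<close> is 0 instead of unimodular; nonnegativity of
        \<open>C * norm z\<close> comes from \<open>le\<close>.\<close>
      case True
      then show ?thesis using le [of z] by simp
    qed (simp add: norm_scaleC norm_sgn)
    finally show ?thesis .
  qed
  have "\<phi> \<in> normed_dual UNIV norm" using add scale bound by (auto simp: normed_dual_def)
  then show thesis using that bound by (simp add: \<phi>_def)
qed

lemma normed_dual_bounded_linear:
  fixes \<phi> :: "'x::complex_normed_vector \<Rightarrow> complex"
  assumes "\<phi> \<in> normed_dual UNIV norm"
  shows "bounded_linear \<phi>"
proof -
  obtain C where "\<forall>z. cmod (\<phi> z) \<le> C * norm z" using assms by (auto simp: normed_dual_def)
  then show ?thesis
    using assms by (intro bounded_linear_intro [of _ C])
      (auto simp: normed_dual_def scaleR_scaleC scaleC_complex_def mult.commute)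
qed

lemma is_predualD:
  assumes "is_predual J"
  shows "bounded_linear (J z)" "onorm (J z) = norm z"
proof -
  have "J z \<in> normed_dual UNIV norm" using assms unfolding is_predual_def by blast
  then show "bounded_linear (J z)" by (rule normed_dual_bounded_linear)
  show "onorm (J z) = norm z" using assms by (simp add: is_predual_def)
qed

text \<open>For the full dual this is Hahn--Banach. For a predual the operator norm of
  \<open>J x\<close> is a supremum of quotients, approached up to \<open>e\<close> by a normalized
  \<open>y\<close>.\<close>

lemma compatible_norming:
  fixes \<tau> :: "'x::cbanach topology" and J :: "'x \<Rightarrow> 'y::cbanach \<Rightarrow> complex"
  assumes compat: "compatible_to_dual_pair \<tau> J" and "e > 0"
  obtains \<psi> where "\<psi> \<in> topological_dual \<tau>" "\<And>z. cmod (\<psi> z) \<le> norm z" "norm x - e \<le> cmod (\<psi> x)"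
proof -
  consider "topological_dual \<tau> = normed_dual UNIV norm"
    | "is_predual J" "topological_dual \<tau> = {(\<lambda>x. J x y) | y. True}"
    using compat by (auto simp: compatible_to_dual_pair_def)
  then show thesis
  proof cases
    case 1
    obtain u where u: "linear u" "\<And>z. \<bar>u z\<bar> \<le> norm z" "u x = norm x"
      by (rule real_norming_functional [of x]) blast
    then obtain \<phi> where \<phi>: "\<phi> \<in> normed_dual UNIV norm" "\<And>z. cmod (\<phi> z) \<le> 1 * norm z" "\<And>z. Re (\<phi> z) = u z"
      using complexified_functional [of u 1] by auto
    have "norm x \<le> cmod (\<phi> x)" using \<phi>(3) [of x] u(3) complex_Re_le_cmod [of "\<phi> x"] by simp
    then show thesis using that [of \<phi>] \<phi> 1 \<open>e > 0\<close> by simp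
  next
    case 2
    note J = is_predualD [OF 2(1)]
    have "norm x - e < (SUP y. norm (J x y) / norm y)"
      using J(2) [of x] \<open>e > 0\<close> by (simp add: onorm_def)
    moreover have "bdd_above (range (\<lambda>y. norm (J x y) / norm y))"
      by (rule bdd_aboveI2 [of _ _ "norm x"])
        (use onorm [OF J(1)] J(2) in \<open>auto simp: divide_le_eq\<close>)
    ultimately obtain y where y: "norm x - e < norm (J x y) / norm y"
      using less_cSUP_iff [of UNIV "\<lambda>y. norm (J x y) / norm y"] by auto
    define y' where "y' = inverse (norm y) *\<^sub>R y"
    have "J x y' = inverse (norm y) *\<^sub>R J x y"
      unfolding y'_def by (simp add: linear_scale bounded_linear.linear [OF J(1)])
    then have "norm x - e \<le> cmod (J x y')" using y by (simp add: divide_inverse mult.commute)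
    moreover have "cmod (J z y') \<le> norm z" for z
    proof -
      have "cmod (J z y') \<le> norm z * norm y'" using onorm [OF J(1), of z y'] J(2) by simp
      moreover have "norm y' \<le> 1" by (cases "y = 0") (simp_all add: y'_def)
      then have "norm z * norm y' \<le> norm z" by (intro mult_left_le) simp_all
      ultimately show ?thesis by linarith
    qed
    ultimately show thesis using that [of "\<lambda>z. J z y'"] 2(2) by blast
  qed
qed

text \<open>Compactness makes \<open>f\<close> bounded under each functional of the topological
  dual. Uniform boundedness then applies to the evaluations at \<open>f t\<close> on the dual, or to
  the functionals \<open>J (f t)\<close> on the predual.\<close>

lemma compatible_bounded:
  fixes \<tau> :: "'x::cbanach topology" and J :: "'x \<Rightarrow> 'y::cbanach \<Rightarrow> complex"
    and f :: "'k::topological_space \<Rightarrow> 'x"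
  assumes compat: "compatible_to_dual_pair \<tau> J" and "compact (UNIV :: 'k set)" and f: "f \<in> Cont \<tau>"
  shows "bdd_above (range (\<lambda>t. norm (f t)))"
proof -
  have weakly_bounded: "\<exists>C. \<forall>t. cmod (\<psi> (f t)) \<le> C" if "\<psi> \<in> topological_dual \<tau>" for \<psi>
  proof -
    have "continuous_map euclidean \<tau> f" "continuous_map \<tau> euclidean \<psi>"
      using f that by (simp_all add: Cont_def topological_dual_def)
    then have "continuous_map euclidean euclidean (\<psi> \<circ> f)" by (rule continuous_map_compose)
    then have "compact (range (\<psi> \<circ> f))"
      using assms(2) by (intro compact_continuous_image) (auto simp: continuous_map_iff_continuous2)
    then show ?thesis using compact_imp_bounded by (fastforce simp: bounded_iff)
  qed
  consider "topological_dual \<tau> = normed_dual UNIV norm"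
    | "is_predual J" "topological_dual \<tau> = {(\<lambda>x. J x y) | y. True}"
    using compat by (auto simp: compatible_to_dual_pair_def)
  then show ?thesis
  proof cases
    case 1
    \<comment> \<open>The dual enters as the Banach space of bounded real-linear functionals;
      complexification carries weak boundedness over to them.\<close>
    have bdd: "\<exists>C. \<forall>t\<in>UNIV. norm (blinfun_apply u (f t)) \<le> C" for u :: "'x \<Rightarrow>\<^sub>L real"
    proof -
      have "linear (blinfun_apply u)" by (simp add: blinfun.bounded_linear_right bounded_linear.linear)
      moreover have "\<bar>blinfun_apply u z\<bar> \<le> norm u * norm z" for z
        using norm_blinfun [of u z] by simp
      ultimately obtain \<phi> where \<phi>: "\<phi> \<in> normed_dual UNIV norm" "\<And>z. Re (\<phi> z) = u z"
        using complexified_functional by metis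
      then obtain C where "\<And>t. cmod (\<phi> (f t)) \<le> C" using weakly_bounded 1 by blast
      then have "norm (u (f t)) \<le> C" for t
        using abs_Re_le_cmod [of "\<phi> (f t)"] \<phi>(2) by (metis order_trans real_norm_def)
      then show ?thesis by blast
    qed
    have "\<exists>C. \<forall>t\<in>UNIV. \<forall>u :: 'x \<Rightarrow>\<^sub>L real. norm (blinfun_apply u (f t)) \<le> C * norm u"
      by (rule uniform_boundedness) (rule blinfun.bounded_linear_left, rule bdd)
    then obtain C where C: "\<And>t (u :: 'x \<Rightarrow>\<^sub>L real). norm (blinfun_apply u (f t)) \<le> C * norm u" by blast
    have "norm (f t) \<le> \<bar>C\<bar>" for t
    proof -
      obtain u where u: "linear u" "\<And>z. \<bar>u z\<bar> \<le> norm z" "u (f t) = norm (f t)"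
        by (rule real_norming_functional [of "f t"]) blast
      have bl: "bounded_linear u"
        using u by (intro bounded_linear_intro [of _ 1]) (auto simp: linear_add linear_scale)
      have "norm (Blinfun u) \<le> 1"
        using u by (intro norm_blinfun_bound) (auto simp: bounded_linear_Blinfun_apply [OF bl])
      have "norm (f t) \<le> C * norm (Blinfun u)"
        using C [of "Blinfun u" t] u(3) by (simp add: bounded_linear_Blinfun_apply [OF bl])
      also have "\<dots> \<le> \<bar>C\<bar> * 1"
        using \<open>norm (Blinfun u) \<le> 1\<close> by (intro mult_mono) auto
      finally show ?thesis by simp
    qed
    then show ?thesis by (intro bdd_aboveI2)
  next
    case 2
    note J = is_predualD [OF 2(1)]
    have bdd: "\<exists>C. \<forall>t\<in>UNIV. norm (J (f t) y) \<le> C" for y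
    proof -
      have "(\<lambda>x. J x y) \<in> topological_dual \<tau>" using 2(2) by auto
      then show ?thesis using weakly_bounded by simp
    qed
    have "\<exists>C. \<forall>t\<in>UNIV. \<forall>y. norm (J (f t) y) \<le> C * norm y"
      by (rule uniform_boundedness) (rule J, rule bdd)
    then obtain C where C: "\<And>t y. norm (J (f t) y) \<le> C * norm y" by blast
    have "norm (f t) \<le> \<bar>C\<bar>" for t
    proof -
      have "norm (J (f t) y) \<le> \<bar>C\<bar> * norm y" for y
        using C [of t y] by (meson abs_ge_self mult_right_mono norm_ge_zero order_trans)
      then show ?thesis using onorm_bound [of "\<bar>C\<bar>" "J (f t)"] J(2) by simp
    qed
    then show ?thesis by (intro bdd_aboveI2)
  qed
qed

section \<open>Function spaces over uniform algebras as function modules\<close>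

lemma uniform_algebra_separating:
  fixes A :: "('k::t2_space \<Rightarrow> complex) set"
  assumes A: "uniform_algebra A" and "compact (UNIV :: 'k set)"
  shows "separating_algebra A"
proof
  show "continuous_on UNIV f" if "f \<in> A" for f
    using A that by (auto simp: uniform_algebra_def sup_closed_def Cont_def continuous_map_iff_continuous2)
  have "csubspace A" using A by (simp add: uniform_algebra_def)
  then show "(\<lambda>t. f t + g t) \<in> A" if "f \<in> A" "g \<in> A" for f g
    using complex_vector.subspace_add [OF _ that] by (simp add: plus_fun_def)
  show "(\<lambda>t. f t * g t) \<in> A" if "f \<in> A" "g \<in> A" for f g
    using A that by (simp add: uniform_algebra_def times_fun_def)
qed (use assms in \<open>auto simp: uniform_algebra_def\<close>)

theorem theorem4p2:
  fixes \<tau> :: "'x::cbanach topology"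
    and J :: "'x \<Rightarrow> 'y::cbanach \<Rightarrow> complex"
    and F :: "('k::t2_space \<Rightarrow> 'x) set"
  assumes "compact (UNIV :: 'k set)"
    and "\<exists>x::'x. x \<noteq> 0"
    and "compatible_to_dual_pair \<tau> J"
    and "function_space_over_uniform_algebra \<tau> F"
    and "infinite_dimensional (base_algebra \<tau> F)"
  shows "diameter_two_property F sup_norm"
proof -
  let ?A = "base_algebra \<tau> F"
  have F: "csubspace F" "sup_closed \<tau> F" "uniform_algebra ?A"
      "\<And>a f. a \<in> ?A \<Longrightarrow> f \<in> F \<Longrightarrow> (\<lambda>t. a t *\<^sub>C f t) \<in> F"
    using assms(4) by (auto simp: function_space_over_uniform_algebra_def)
  interpret separating_algebra ?A using F(3) assms(1) by (rule uniform_algebra_separating)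
  have "function_module ?A F"
  proof
    show "bdd_above (range (\<lambda>t. norm (f t)))" if "f \<in> F" for f
      using compatible_bounded [OF assms(3,1)] F(2) that by (auto simp: sup_closed_def)
    show "\<exists>\<psi>. \<psi> \<circ> f \<in> ?A \<and> (\<forall>x. cmod (\<psi> x) \<le> norm x) \<and> norm (f s) - e \<le> cmod (\<psi> (f s))"
      if "f \<in> F" "e > 0" for f s and e :: real
    proof -
      obtain \<psi> where "\<psi> \<in> topological_dual \<tau>" "\<And>z. cmod (\<psi> z) \<le> norm z" "norm (f s) - e \<le> cmod (\<psi> (f s))"
        using compatible_norming [OF assms(3) \<open>e > 0\<close>] by metis
      then show ?thesis using \<open>f \<in> F\<close> by (auto simp: base_algebra_def)
    qed
    show "\<exists>f\<in>F. \<forall>t. f t \<noteq> 0"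
    proof -
      \<comment> \<open>The constant 1 lies in the base algebra, so it is some
        \<open>\<psi> \<circ> f\<close>; as \<open>\<psi> 0 = 0\<close>, this \<open>f\<close> has
        no zeros.\<close>
      obtain \<psi> f where \<psi>: "(\<lambda>t. 1) = \<psi> \<circ> f" "f \<in> F" "\<psi> \<in> topological_dual \<tau>"
        using const [of 1] by (auto simp: base_algebra_def)
      have "\<psi> (0 *\<^sub>C 0) = 0 * \<psi> 0"
        using \<psi>(3) unfolding topological_dual_def by blast
      then have "\<psi> 0 = 0" by simp
      moreover have "\<psi> (f t) = 1" for t using fun_cong [OF \<psi>(1), of t] by simp
      ultimately have "f t \<noteq> 0" for t by (metis zero_neq_one)
      then show ?thesis using \<psi>(2) by blast
    qed
    show "infinite \<Gamma>" using assms(5) by (rule infinite_\<Gamma>)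
  qed (use F in auto)
  then show ?thesis by (rule function_module.diameter_two)
qed

end
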